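(* Let $\Delta t>0$ be a time step, $T>0$ a final time, $N_T:=\lfloor T/\Delta t\rfloor$, $t^n:=n\Delta t$. For $\varepsilon\in(0,1]$ and initial data $(\mathbf Z^0(\varepsilon),\mathbf u_\perp^0(\varepsilon))$, let $(\mathbf Z^n(\varepsilon),\mathbf u_\perp^n(\varepsilon))_{0\le n\le N_T}$ be the sequence obtained from the semi-implicit scheme $$\frac{\mathbf Z^{n+1}-\mathbf Z^n}{\Delta t}=\mathbf F(t^n,\mathbf Z^n,\mathbf u_\perp^{n+1}),\qquad \mathbf J_0\frac{\mathbf u_\perp^{n+1}-\mathbf u_\perp^n}{\Delta t}=\mathbf U_\perp(t^n,\mathbf Z^n,\mathbf u_\perp^n)-\frac{b(\mathbf Z^n)\,\mathbf u_\perp^{n+1}}{\varepsilon},$$ where $\mathbf J_0,\mathbf F,\mathbf U_\perp,\overline{\mathbf U}_\perp,b$ and the standing assumptions are given in the context. (i) Assume that $(\mathbf Z^0(\varepsilon),\sqrt\varepsilon\,\mathbf u_\perp^0(\varepsilon))_{\varepsilon>0}$ converges, as $\varepsilon\to0$, to $(\mathbf Z^0,0)$ for some $\mathbf Z^0$. Then, for any $1\le n\le N_T$, $(\mathbf Z^n(\varepsilon),\mathbf u_\perp^n(\varepsilon))_{\varepsilon>0}$ converges to $(\mathbf Z^n,0)$ as $\varepsilon\to0$, where $(\mathbf Z^n)_{0\le n\le N_T}$ starts from $\mathbf Z^0$ and satisfies $$\frac{\mathbf Z^{n+1}-\mathbf Z^n}{\Delta t}=\mathbf F(t^n,\mathbf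 Z^n,0),\qquad 0\le n\le N_T-1,\tag{A}$$ which provides a consistent first-order approximation with respect to $\Delta t$ of the gyro-kinetic system $\frac{d\mathbf Z}{dt}=\mathbf F(t,\mathbf Z,0)$. (ii) Alternatively, make the stronger assumption that for some $M>0$ and some $\mathbf Z^0$, the family $\big((\mathbf Z^0(\varepsilon)-\mathbf Z^0)/\varepsilon,\ \mathbf u_\perp^0(\varepsilon)\big)_{\varepsilon>0}$ is bounded by $M$, uniformly with respect to $\varepsilon$. Then, for some $C_M$ depending only on $M$, $\Delta t$ and $T$, for any $1\le n\le N_T$, $$\|\mathbf Z^n(\varepsilon)-\mathbf Z^n\|+\|\mathbf u_\perp^n(\varepsilon)\|\le C_M\,\varepsilon,$$ where $(\mathbf Z^n)_{0\le n\le N_T}$ is obtained from (A), and, for any $2\le n\le N_T$, $$\|\mathbf Z^n(\varepsilon)-\mathbf Y^n(\varepsilon)\|+\left\|\mathbf u_\perp^n(\varepsilon)-\varepsilon\,\frac{\overline{\mathbf U}_\perp(t^{n-1},\mathbf Y^{n-1}(\varepsilon))}{b(\mathbf Y^{n-1}(\varepsilon))}\right\|\le C_M\,\varepsilon^2,$$ where $(\mathbf Y^n(\varepsilon))_{1\le n\le N_T}$ is obtained from $\mathbf Y^1(\varepsilon)=\mathbf Z^1(\varepsilon)$ and $$\frac{\mathbf Y^{n+1}(\varepsilon)-\mathbf Y^n(\varepsilon)}{\Delta t}=\mathbf F\Big(t^n,\mathbf Y^n(\varepsilon),\varepsilon\,\frac{\overline{\mathbf U}_\perp(t^n,\mathbf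 Y^n(\varepsilon))}{b(\mathbf Y^n(\varepsilon))}\Big),\qquad 1\le n\le N_T-1,$$ which provides a consistent first-order approximation with respect to $\Delta t$ of the system $\frac{d\mathbf Z}{dt}=\mathbf F\big(t,\mathbf Z,\tfrac{\varepsilon}{b(\mathbf Z)}\overline{\mathbf U}_\perp(t,\mathbf Z)\big)$.
   Context: Variables: $\mathbf Z=(r,\varphi,\theta,v_\parallel,b\mu)$, where $b\mu$ is a single independent real variable, and $\mathbf u_\perp=(u_r,u_\perp)\in\mathbb R^2$. Here $(r,\theta,\varphi)$ are toroidal coordinates: $R_0>0$ is fixed, $r\in(0,R_0)$, $\theta,\varphi$ are angles (all fields are $2\pi$-periodic in them), and $R=R(r,\theta)=R_0+r\cos\theta$. Fixed data: real functions $b=b(r,\theta)>0$ (magnetic field intensity) and $\omega=\omega(r,\theta)$ (magnetic field direction angle), and functions $E_r,E_\theta,E_\varphi$ of $(t,r,\theta,\varphi)$ (components of the electric field in the toroidal orthonormal frame). Set $E_\parallel=\cos\omega\,E_\varphi+\sin\omega\,E_\theta$, $E_\perp=\sin\omega\,E_\varphi-\cos\omega\,E_\theta$, $\mathbf E_\perp=(E_r,E_\perp)$. Write $b(\mathbf Z)=b(r,\theta)$ and $\mu:=(b\mu)/b(r,\theta)$. Standing assumptions: the fields are boundedly smooth, $b$ does not vanish, and $\varepsilon$ is bounded above, say by $1$. Coefficients, functions of $(r,\theta)$: $\alpha=-\frac{\partial_\theta\omega}{r}\sin\omega-\frac{\sin\theta}{R}\cos\omega$, $\ \beta=\frac{\partial_\theta\omega}{r}\cos\omega-\frac{\sin\theta}{R}\sin\omega$,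 $\ \gamma=-\frac{\sin^2\omega}{r}-\frac{\cos\theta}{R}\cos^2\omega$, $\ \delta=-\big(\frac{\cos\theta}{R}-\frac1r\big)\sin\omega\cos\omega$, $\ \zeta=\frac{\cos^2\omega}{r}+\frac{\cos\theta}{R}\sin^2\omega$, $\ \eta=-\frac{\sin\omega}{r}\frac{\partial_\theta b}{b}$, $\ \kappa=\frac{\cos\omega}{r}\frac{\partial_\theta b}{b}$, $\ \lambda=-\frac{\partial_r b}{b}$. $\mathbf J_0=\begin{pmatrix}0&1\\-1&0\end{pmatrix}$. $$\mathbf F(t,\mathbf Z,\mathbf u_\perp)=\Big(b\,u_r,\ \tfrac{\cos\omega\,v_\parallel+b\sin\omega\,u_\perp}{R},\ \tfrac{\sin\omega\,v_\parallel-b\cos\omega\,u_\perp}{r},\ E_\parallel+F_\parallel,\ -v_\parallel F_\parallel+b\langle\mathbf E_\perp,\mathbf u_\perp\rangle\Big),$$ $$F_\parallel=b\Big[(\gamma u_r+\alpha u_\perp)v_\parallel+b(\delta-\partial_r\omega)u_\perp u_r+\beta\Big(\mu+b\,\tfrac{u_\perp^2-u_r^2}{2}\Big)\Big].$$ $\mathbf U_\perp(t,\mathbf Z,\mathbf u_\perp)=(U_r,U_\perp)$ with $$U_r=\tfrac{E_\perp}{b}-\tfrac{\alpha}{b}v_\parallel^2+(\partial_r\omega+\delta)v_\parallel u_r+(\eta-\beta)v_\parallel u_\perp+b(\lambda-\zeta)u_ru_\perp+\kappa\Big(\mu+b\,\tfrac{u_\perp^2-u_r^2}{2}\Big),$$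 $$U_\perp=-\tfrac{E_r}{b}+2\delta v_\parallel u_\perp-\zeta b u_\perp^2+\tfrac{\gamma}{b}v_\parallel^2-\eta u_rv_\parallel-\kappa b\,u_ru_\perp-\lambda\Big(\mu-b\,\tfrac{u_\perp^2-u_r^2}{2}\Big).$$ $\overline{\mathbf U}_\perp(t,\mathbf Z):=\mathbf U_\perp(t,\mathbf Z,0)$, i.e. $\overline U_r=\frac1b(E_\perp-\alpha v_\parallel^2+\kappa\,b\mu)$, $\overline U_\perp=\frac1b(-E_r+\gamma v_\parallel^2-\lambda\,b\mu)$. The system $\frac{d\mathbf Z}{dt}=\mathbf F(t,\mathbf Z,0)$ reads explicitly $\dot r=0$, $\dot\varphi=\frac{\cos\omega\,v_\parallel}{R}$, $\dot\theta=\frac{\sin\omega\,v_\parallel}{r}$, $\dot v_\parallel=E_\parallel+\beta\,b\mu$, $\frac{d(b\mu)}{dt}=-v_\parallel\beta\,b\mu$.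
   Formalization: In (ii), C_M may also depend on the fields and on bounds for Z^0 (radius in a compact part of (0,R_0), |v_par|, |bμ| bounded); the estimates are claimed for ε≤ε_0, or for all ε≤1 when the radii of the iterates used stay in that compact range; with C_M depending only on M, Δt, T they fail. *)

theory Defs
  imports "HOL-Analysis.Analysis"
begin

section \<open>Fields in toroidal coordinates\<close>

text \<open>
  Fields are total functions on the reals; only their values for \<open>0 \<le> t\<close> and
  \<open>0 < r < R0\<close> are constrained by the standing assumptions.  Angles are real numbers
  (lifts of elements of the circle).
\<close>

record toroidal_data =
  R0 :: real
  bfield :: "real \<Rightarrow> real \<Rightarrow> real" \<comment> \<open>arguments \<open>r \<theta>\<close>\<close>
  omega :: "real \<Rightarrow> real \<Rightarrow> real"  \<comment> \<open>arguments \<open>r \<theta>\<close>\<close>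
  E_r :: "real \<Rightarrow> real \<Rightarrow> real \<Rightarrow> real \<Rightarrow> real" \<comment> \<open>arguments \<open>t r \<theta> \<phi>\<close>, also below\<close>
  E_theta :: "real \<Rightarrow> real \<Rightarrow> real \<Rightarrow> real \<Rightarrow> real"
  E_phi :: "real \<Rightarrow> real \<Rightarrow> real \<Rightarrow> real \<Rightarrow> real"

text \<open>\<open>bounded_Ck k S f\<close>: all (iterated, directional) derivatives of \<open>f\<close> on \<open>S\<close> up to
  order \<open>k\<close> exist and are bounded and continuous.  It is only used on convex sets with
  nonempty interior, where derivatives within \<open>S\<close> are unique.\<close>

primrec bounded_Ck :: "nat \<Rightarrow> 'a::euclidean_space set \<Rightarrow> ('a \<Rightarrow> real) \<Rightarrow> bool" where
  "bounded_Ck 0 S f \<longleftrightarrow> continuous_on S f \<and> bounded (f ` S)"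
| "bounded_Ck (Suc k) S f \<longleftrightarrow> continuous_on S f \<and> bounded (f ` S) \<and>
     (\<exists>f'. (\<forall>x\<in>S. (f has_derivative f' x) (at x within S)) \<and>
           (\<forall>i\<in>Basis. bounded_Ck k S (\<lambda>x. f' x i)))"

definition boundedly_smooth :: "'a::euclidean_space set \<Rightarrow> ('a \<Rightarrow> real) \<Rightarrow> bool" where
  "boundedly_smooth S f \<longleftrightarrow> (\<forall>k. bounded_Ck k S f)"

definition standing_assumptions :: "toroidal_data \<Rightarrow> bool" where
  "standing_assumptions D \<longleftrightarrow>
     0 < R0 D \<and>
     (\<forall>r \<theta>. 0 < r \<and> r < R0 D \<longrightarrow>
        0 < bfield D r \<theta> \<and>
        bfield D r (\<theta> + 2 * pi) = bfield D r \<theta> \<and>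
        omega D r (\<theta> + 2 * pi) = omega D r \<theta>) \<and>
     (\<forall>E \<in> {E_r D, E_theta D, E_phi D}. \<forall>t r \<theta> \<phi>. 0 \<le> t \<and> 0 < r \<and> r < R0 D \<longrightarrow>
        E t r (\<theta> + 2 * pi) \<phi> = E t r \<theta> \<phi> \<and> E t r \<theta> (\<phi> + 2 * pi) = E t r \<theta> \<phi>) \<and>
     (\<forall>g \<in> {bfield D, omega D}.
        boundedly_smooth ({0<..<R0 D} \<times> UNIV) (\<lambda>(r, \<theta>). g r \<theta>)) \<and>
     (\<forall>E \<in> {E_r D, E_theta D, E_phi D}.
        boundedly_smooth ({0..} \<times> {0<..<R0 D} \<times> UNIV \<times> UNIV) (\<lambda>(t, r, \<theta>, \<phi>). E t r \<theta> \<phi>))"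

definition RR :: "toroidal_data \<Rightarrow> real \<Rightarrow> real \<Rightarrow> real" where
  "RR D r \<theta> = R0 D + r * cos \<theta>"

definition E_par :: "toroidal_data \<Rightarrow> real \<Rightarrow> real \<Rightarrow> real \<Rightarrow> real \<Rightarrow> real" where
  "E_par D t r \<theta> \<phi> = cos (omega D r \<theta>) * E_phi D t r \<theta> \<phi> + sin (omega D r \<theta>) * E_theta D t r \<theta> \<phi>"

definition E_perp :: "toroidal_data \<Rightarrow> real \<Rightarrow> real \<Rightarrow> real \<Rightarrow> real \<Rightarrow> real" where
  "E_perp D t r \<theta> \<phi> = sin (omega D r \<theta>) * E_phi D t r \<theta> \<phi> - cos (omega D r \<theta>) * E_theta D t r \<theta> \<phi>"

definition dr :: "(real \<Rightarrow> real \<Rightarrow> real) \<Rightarrow> real \<Rightarrow> real \<Rightarrow> real" where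
  "dr g r \<theta> = deriv (\<lambda>s. g s \<theta>) r"

definition dtheta :: "(real \<Rightarrow> real \<Rightarrow> real) \<Rightarrow> real \<Rightarrow> real \<Rightarrow> real" where
  "dtheta g r \<theta> = deriv (\<lambda>s. g r s) \<theta>"

definition c_alpha :: "toroidal_data \<Rightarrow> real \<Rightarrow> real \<Rightarrow> real" where
  "c_alpha D r \<theta> = - (dtheta (omega D) r \<theta> / r) * sin (omega D r \<theta>)
     - (sin \<theta> / RR D r \<theta>) * cos (omega D r \<theta>)"

definition c_beta :: "toroidal_data \<Rightarrow> real \<Rightarrow> real \<Rightarrow> real" where
  "c_beta D r \<theta> = (dtheta (omega D) r \<theta> / r) * cos (omega D r \<theta>)
     - (sin \<theta> / RR D r \<theta>) * sin (omega D r \<theta>)"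

definition c_gamma :: "toroidal_data \<Rightarrow> real \<Rightarrow> real \<Rightarrow> real" where
  "c_gamma D r \<theta> = - ((sin (omega D r \<theta>))\<^sup>2 / r) - (cos \<theta> / RR D r \<theta>) * (cos (omega D r \<theta>))\<^sup>2"

definition c_delta :: "toroidal_data \<Rightarrow> real \<Rightarrow> real \<Rightarrow> real" where
  "c_delta D r \<theta> = - (cos \<theta> / RR D r \<theta> - 1 / r) * sin (omega D r \<theta>) * cos (omega D r \<theta>)"

definition c_zeta :: "toroidal_data \<Rightarrow> real \<Rightarrow> real \<Rightarrow> real" where
  "c_zeta D r \<theta> = (cos (omega D r \<theta>))\<^sup>2 / r + (cos \<theta> / RR D r \<theta>) * (sin (omega D r \<theta>))\<^sup>2"

definition c_eta :: "toroidal_data \<Rightarrow> real \<Rightarrow> real \<Rightarrow> real" where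
  "c_eta D r \<theta> = - (sin (omega D r \<theta>) / r) * (dtheta (bfield D) r \<theta> / bfield D r \<theta>)"

definition c_kappa :: "toroidal_data \<Rightarrow> real \<Rightarrow> real \<Rightarrow> real" where
  "c_kappa D r \<theta> = (cos (omega D r \<theta>) / r) * (dtheta (bfield D) r \<theta> / bfield D r \<theta>)"

definition c_lambda :: "toroidal_data \<Rightarrow> real \<Rightarrow> real \<Rightarrow> real" where
  "c_lambda D r \<theta> = - (dr (bfield D) r \<theta> / bfield D r \<theta>)"

section \<open>The slow and fast right-hand sides\<close>

text \<open>
  The slow variable is \<open>(r, \<phi>, \<theta>, v, w)\<close> with \<open>v\<close> the parallel velocity and \<open>w\<close> the
  single variable \<open>b\<mu>\<close> (so \<open>\<mu> = w / b\<close>); the fast variable is \<open>(u\<^sub>r, u\<^sub>\<bottom>)\<close>.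
  The norms of the product types are the Euclidean ones.
\<close>

type_synonym slow = "real \<times> real \<times> real \<times> real \<times> real"
type_synonym fast = "real \<times> real"

fun radius :: "slow \<Rightarrow> real" where "radius (r, \<phi>, \<theta>, v, w) = r"
fun v_par :: "slow \<Rightarrow> real" where "v_par (r, \<phi>, \<theta>, v, w) = v"
fun b_mu :: "slow \<Rightarrow> real" where "b_mu (r, \<phi>, \<theta>, v, w) = w"
fun b_at :: "toroidal_data \<Rightarrow> slow \<Rightarrow> real" where "b_at D (r, \<phi>, \<theta>, v, w) = bfield D r \<theta>"

definition slow_domain :: "toroidal_data \<Rightarrow> slow set" where
  "slow_domain D = {Z. 0 < radius Z \<and> radius Z < R0 D}"

fun J0 :: "fast \<Rightarrow> fast" where "J0 (x, y) = (y, - x)"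

fun F_par :: "toroidal_data \<Rightarrow> slow \<Rightarrow> fast \<Rightarrow> real" where
  "F_par D (r, \<phi>, \<theta>, v, w) (ur, up) =
    (let b = bfield D r \<theta>; \<mu> = w / b in
     b * ((c_gamma D r \<theta> * ur + c_alpha D r \<theta> * up) * v
          + b * (c_delta D r \<theta> - dr (omega D) r \<theta>) * up * ur
          + c_beta D r \<theta> * (\<mu> + b * ((up\<^sup>2 - ur\<^sup>2) / 2))))"

fun F :: "toroidal_data \<Rightarrow> real \<Rightarrow> slow \<Rightarrow> fast \<Rightarrow> slow" where
  "F D t (r, \<phi>, \<theta>, v, w) (ur, up) =
    (let b = bfield D r \<theta>; \<omega> = omega D r \<theta>; Fp = F_par D (r, \<phi>, \<theta>, v, w) (ur, up) in
     ( b * ur,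
       (cos \<omega> * v + b * sin \<omega> * up) / RR D r \<theta>,
       (sin \<omega> * v - b * cos \<omega> * up) / r,
       E_par D t r \<theta> \<phi> + Fp,
       - v * Fp + b * (E_r D t r \<theta> \<phi> * ur + E_perp D t r \<theta> \<phi> * up)))"

fun U_perp :: "toroidal_data \<Rightarrow> real \<Rightarrow> slow \<Rightarrow> fast \<Rightarrow> fast" where
  "U_perp D t (r, \<phi>, \<theta>, v, w) (ur, up) =
    (let b = bfield D r \<theta>; \<mu> = w / b;
         \<alpha> = c_alpha D r \<theta>; \<beta> = c_beta D r \<theta>; \<gamma> = c_gamma D r \<theta>; \<delta> = c_delta D r \<theta>;
         \<zeta> = c_zeta D r \<theta>; \<eta> = c_eta D r \<theta>; \<kappa> = c_kappa D r \<theta>; lam = c_lambda D r \<theta> in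
     ( E_perp D t r \<theta> \<phi> / b - \<alpha> / b * v\<^sup>2
         + (dr (omega D) r \<theta> + \<delta>) * v * ur + (\<eta> - \<beta>) * v * up
         + b * (lam - \<zeta>) * ur * up + \<kappa> * (\<mu> + b * ((up\<^sup>2 - ur\<^sup>2) / 2)),
       - (E_r D t r \<theta> \<phi> / b) + 2 * \<delta> * v * up - \<zeta> * b * up\<^sup>2 + \<gamma> / b * v\<^sup>2
         - \<eta> * ur * v - \<kappa> * b * ur * up - lam * (\<mu> - b * ((up\<^sup>2 - ur\<^sup>2) / 2))))"

definition Ubar :: "toroidal_data \<Rightarrow> real \<Rightarrow> slow \<Rightarrow> fast" where
  "Ubar D t Z = U_perp D t Z 0"

definition gyrokinetic_field :: "toroidal_data \<Rightarrow> real \<Rightarrow> slow \<Rightarrow> slow" where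
  "gyrokinetic_field D t Z = F D t Z 0"

definition slaved_velocity :: "toroidal_data \<Rightarrow> real \<Rightarrow> real \<Rightarrow> slow \<Rightarrow> fast" where
  "slaved_velocity D \<epsilon> t Z = (\<epsilon> / b_at D Z) *\<^sub>R Ubar D t Z"

definition corrected_field :: "toroidal_data \<Rightarrow> real \<Rightarrow> real \<Rightarrow> slow \<Rightarrow> slow" where
  "corrected_field D \<epsilon> t Z = F D t Z (slaved_velocity D \<epsilon> t Z)"

section \<open>Schemes\<close>

definition num_steps :: "real \<Rightarrow> real \<Rightarrow> nat" where
  "num_steps T h = nat \<lfloor>T / h\<rfloor>"

definition semi_implicit_scheme ::
  "toroidal_data \<Rightarrow> real \<Rightarrow> nat \<Rightarrow> real \<Rightarrow> (nat \<Rightarrow> slow) \<Rightarrow> (nat \<Rightarrow> fast) \<Rightarrow> bool" where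
  "semi_implicit_scheme D h N \<epsilon> Z u \<longleftrightarrow> (\<forall>n<N.
     (Z (Suc n) - Z n) /\<^sub>R h = F D (real n * h) (Z n) (u (Suc n)) \<and>
     J0 ((u (Suc n) - u n) /\<^sub>R h) =
       U_perp D (real n * h) (Z n) (u n) - (b_at D (Z n) / \<epsilon>) *\<^sub>R u (Suc n))"

text \<open>\<open>one_step_scheme h m N \<Phi> W\<close>: the sequence \<open>(W n)\<close>, \<open>m \<le> n \<le> N\<close>, satisfies
  \<open>(W (n+1) - W n) / h = \<Phi> (n h) (W n)\<close>.\<close>

definition one_step_scheme ::
  "real \<Rightarrow> nat \<Rightarrow> nat \<Rightarrow> (real \<Rightarrow> 'a::real_normed_vector \<Rightarrow> 'a) \<Rightarrow> (nat \<Rightarrow> 'a) \<Rightarrow> bool" where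
  "one_step_scheme h m N \<Phi> W \<longleftrightarrow>
     (\<forall>n. m \<le> n \<and> n < N \<longrightarrow> (W (Suc n) - W n) /\<^sub>R h = \<Phi> (real n * h) (W n))"

definition solves_on ::
  "real \<Rightarrow> 'a set \<Rightarrow> (real \<Rightarrow> 'a::real_normed_vector \<Rightarrow> 'a) \<Rightarrow> (real \<Rightarrow> 'a) \<Rightarrow> bool" where
  "solves_on T S G z \<longleftrightarrow>
     (\<forall>t\<in>{0..T}. z t \<in> S \<and> (z has_vector_derivative G t (z t)) (at t within {0..T}))"

text \<open>
  The scheme with increment function \<open>\<Phi>\<close> is a consistent first-order approximation of
  \<open>dz/dt = G t z\<close>: along every exact solution on \<open>[0, T]\<close> the truncation error (the residual
  of the exact solution in the scheme) is \<open>O(h)\<close>, and so is the global error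
  of the scheme started from the exact solution at any grid time.
\<close>

definition consistent_first_order ::
  "real \<Rightarrow> 'a set \<Rightarrow> (real \<Rightarrow> 'a::real_normed_vector \<Rightarrow> 'a) \<Rightarrow> (real \<Rightarrow> 'a \<Rightarrow> 'a) \<Rightarrow> bool" where
  "consistent_first_order T S G \<Phi> \<longleftrightarrow> (\<forall>z. solves_on T S G z \<longrightarrow>
     (\<exists>C. \<forall>h>0. \<forall>n<num_steps T h.
        norm ((z (real (Suc n) * h) - z (real n * h)) /\<^sub>R h - \<Phi> (real n * h) (z (real n * h)))
          \<le> C * h) \<and>
     (\<exists>C. \<exists>h0>0. \<forall>h m W. 0 < h \<and> h \<le> h0 \<and> W m = z (real m * h) \<and>
          one_step_scheme h m (num_steps T h) \<Phi> W \<longrightarrow>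
        (\<forall>n\<in>{m..num_steps T h}. norm (W n - z (real n * h)) \<le> C * h)))"

end

theory Submission
  imports Defs
begin

text \<open>
  On radii bounded away from \<open>0\<close> and \<open>R0\<close>, with bounded \<open>v\<close>, \<open>w\<close> and \<open>u\<close>, every field of the problem is
  bounded and Lipschitz: periodicity in \<open>\<theta>\<close> bounds \<open>b\<close> away from \<open>0\<close>.  Since \<open>J0\<close> is skew, the matrix
  \<open>J0 / h + b / \<epsilon>\<close> of the implicit step has an inverse of norm at most \<open>\<epsilon> / b\<close>.  One step thus makes \<open>u\<close> of
  size \<open>\<epsilon>\<close>; after two steps the time difference of \<open>u\<close> is itself \<open>O(\<epsilon>)\<close>, so that
  \<open>u = \<epsilon> Ubar / b + O(\<epsilon>\<^sup>2)\<close>.  The slow variables inherit these errors through the Lipschitz constant of \<open>F\<close>.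
  For initial data with merely \<open>sqrt \<epsilon> u \<rightarrow> 0\<close> one uses that \<open>U_perp\<close> is quadratic in \<open>u\<close>.  The limiting
  schemes conserve or barely move the radius, so nothing leaves the region where the bounds hold.
\<close>

section \<open>Bounded Lipschitz functions\<close>

text \<open>Boundedness travels with the Lipschitz property because only the pair is stable under
  products, and on a tube the fields are polynomials in \<open>v\<close>, \<open>w\<close>,
  \<open>u\<close> with bounded coefficients. The obstacle is the boundary of the domain: the
  coefficients may degenerate as the radius tends to 0 or \<open>R0\<close>, and for a given
  \<epsilon> nothing in the scheme keeps the radius away from there. The limiting sequence conserves
  its radius, so a run within O(\<epsilon>) of it stays in a slightly larger tube once \<epsilon> is
  below a threshold; for larger \<epsilon> the confinement of the radii is a hypothesis. Every
  estimate therefore carries the alternative "\<epsilon> below a threshold, or radii in range".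
  Constants and thresholds come from induction on the number of steps and stand outside the
  quantifier over runs. They worsen at each step and contain 1/h, which is harmless because the step
  size and the number of steps are fixed. Consistency concerns only the two explicit Euler schemes
  in the slow variable, the corrected one at fixed \<epsilon>. It is a fact about locally Lipschitz
  fields, separate from the limit in \<epsilon>.\<close>

definition bdd_lipschitz :: "'a::metric_space set \<Rightarrow> ('a \<Rightarrow> 'b::real_normed_vector) \<Rightarrow> bool" where
  "bdd_lipschitz S f \<longleftrightarrow> (\<exists>K. (\<forall>x\<in>S. norm (f x) \<le> K) \<and> K-lipschitz_on S f)"

lemma bdd_lipschitzI:
  assumes "\<And>x. x \<in> S \<Longrightarrow> norm (f x) \<le> B"
    and "\<And>x y. x \<in> S \<Longrightarrow> y \<in> S \<Longrightarrow> norm (f x - f y) \<le> L * dist x y"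
  shows "bdd_lipschitz S f"
  unfolding bdd_lipschitz_def
\<comment> \<open>No sign is known for \<open>B\<close> and \<open>L\<close>, and one constant must
  serve as bound and as Lipschitz constant.\<close>
proof (intro exI[of _ "\<bar>B\<bar> + \<bar>L\<bar>"] conjI ballI lipschitz_onI)
  show "norm (f x) \<le> \<bar>B\<bar> + \<bar>L\<bar>" if "x \<in> S" for x
    using assms(1)[OF that] by linarith
  show "dist (f x) (f y) \<le> (\<bar>B\<bar> + \<bar>L\<bar>) * dist x y" if "x \<in> S" "y \<in> S" for x y
  proof -
    have "L * dist x y \<le> (\<bar>B\<bar> + \<bar>L\<bar>) * dist x y"
      by (intro mult_right_mono) auto
    then show ?thesis
      using assms(2)[OF that] by (simp add: dist_norm)
  qed
qed auto

lemma bdd_lipschitzE: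
  assumes "bdd_lipschitz S f"
  obtains K where "0 < K" "\<And>x. x \<in> S \<Longrightarrow> norm (f x) \<le> K"
    "\<And>x y. x \<in> S \<Longrightarrow> y \<in> S \<Longrightarrow> norm (f x - f y) \<le> K * dist x y"
proof -
  obtain K where K: "\<And>x. x \<in> S \<Longrightarrow> norm (f x) \<le> K" "K-lipschitz_on S f"
    using assms unfolding bdd_lipschitz_def by blast
  have K0: "0 \<le> K"
    using K(2) by (rule lipschitz_on_nonneg)
  show thesis
  \<comment> \<open>The extra 1 makes the constant strictly positive even for the zero function, so
    that constants built from it are positive too.\<close>
  proof (rule that[of "K + 1"])
    show "norm (f x) \<le> K + 1" if "x \<in> S" for x
      using K(1)[OF that] by simp
    show "norm (f x - f y) \<le> (K + 1) * dist x y" if "x \<in> S" "y \<in> S" for x y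
      using lipschitz_onD[OF K(2) that] by (simp add: dist_norm[symmetric] distrib_right add_increasing2)
  qed (use K0 in simp)
qed

lemma bdd_lipschitz_subset:
  "bdd_lipschitz S f \<Longrightarrow> T \<subseteq> S \<Longrightarrow> bdd_lipschitz T f"
  unfolding bdd_lipschitz_def by (meson lipschitz_on_subset subsetD)

lemma bdd_lipschitz_compose:
  assumes "bdd_lipschitz T f" "L-lipschitz_on S g" "g ` S \<subseteq> T"
  shows "bdd_lipschitz S (\<lambda>x. f (g x))"
proof -
  obtain K where K: "0 < K" "\<And>x. x \<in> T \<Longrightarrow> norm (f x) \<le> K"
    "\<And>x y. x \<in> T \<Longrightarrow> y \<in> T \<Longrightarrow> norm (f x - f y) \<le> K * dist x y"
    using bdd_lipschitzE[OF assms(1)] by metis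
  show ?thesis
  proof (rule bdd_lipschitzI)
    show "norm (f (g x)) \<le> K" if "x \<in> S" for x
      using K(2) that assms(3) by blast
    show "norm (f (g x) - f (g y)) \<le> (K * L) * dist x y" if "x \<in> S" "y \<in> S" for x y
    proof -
      have "norm (f (g x) - f (g y)) \<le> K * dist (g x) (g y)"
        using K(3) that assms(3) by blast
      also have "\<dots> \<le> K * (L * dist x y)"
        using lipschitz_onD[OF assms(2) that] K(1) by (simp add: mult_left_mono)
      finally show ?thesis by (simp add: mult.assoc)
    qed
  qed
qed

lemma bdd_lipschitz_const: "bdd_lipschitz S (\<lambda>x. c)"
  by (rule bdd_lipschitzI[where B = "norm c" and L = 0]) auto

lemma bdd_lipschitz_minus: "bdd_lipschitz S f \<Longrightarrow> bdd_lipschitz S (\<lambda>x. - f x)"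
  unfolding bdd_lipschitz_def by simp

lemma bdd_lipschitz_add:
  assumes "bdd_lipschitz S f" "bdd_lipschitz S g"
  shows "bdd_lipschitz S (\<lambda>x. f x + g x)"
proof -
  obtain K K' where "\<And>x. x \<in> S \<Longrightarrow> norm (f x) \<le> K" "K-lipschitz_on S f"
    "\<And>x. x \<in> S \<Longrightarrow> norm (g x) \<le> K'" "K'-lipschitz_on S g"
    using assms unfolding bdd_lipschitz_def by blast
  then have "(\<forall>x\<in>S. norm (f x + g x) \<le> K + K') \<and> (K + K')-lipschitz_on S (\<lambda>x. f x + g x)"
    by (auto intro: lipschitz_on_add norm_triangle_mono)
  then show ?thesis
    unfolding bdd_lipschitz_def by blast
qed

lemma bdd_lipschitz_diff:
  assumes "bdd_lipschitz S f" "bdd_lipschitz S g"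
  shows "bdd_lipschitz S (\<lambda>x. f x - g x)"
  using bdd_lipschitz_add[OF assms(1) bdd_lipschitz_minus[OF assms(2)]] by simp

lemma bdd_lipschitz_scaleR:
  assumes "bdd_lipschitz S f" "bdd_lipschitz S g"
  shows "bdd_lipschitz S (\<lambda>x. f x *\<^sub>R g x)"
proof -
  obtain K where K: "0 < K" "\<And>x. x \<in> S \<Longrightarrow> norm (f x) \<le> K"
    "\<And>x y. x \<in> S \<Longrightarrow> y \<in> S \<Longrightarrow> norm (f x - f y) \<le> K * dist x y"
    using bdd_lipschitzE[OF assms(1)] by metis
  obtain K' where K': "0 < K'" "\<And>x. x \<in> S \<Longrightarrow> norm (g x) \<le> K'"
    "\<And>x y. x \<in> S \<Longrightarrow> y \<in> S \<Longrightarrow> norm (g x - g y) \<le> K' * dist x y"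
    using bdd_lipschitzE[OF assms(2)] by metis
  show ?thesis
  proof (rule bdd_lipschitzI)
    show "norm (f x *\<^sub>R g x) \<le> K * K'" if "x \<in> S" for x
      using K(1) K(2)[OF that] K'(2)[OF that] by (auto intro!: mult_mono)
    show "norm (f x *\<^sub>R g x - f y *\<^sub>R g y) \<le> (2 * K * K') * dist x y" if "x \<in> S" "y \<in> S" for x y
    proof -
      have "f x *\<^sub>R g x - f y *\<^sub>R g y = f x *\<^sub>R (g x - g y) + (f x - f y) *\<^sub>R g y"
        by (simp add: algebra_simps)
      also have "norm \<dots> \<le> \<bar>f x\<bar> * norm (g x - g y) + \<bar>f x - f y\<bar> * norm (g y)"
        by (rule norm_triangle_le) simp
      also have "\<dots> \<le> K * (K' * dist x y) + (K * dist x y) * K'"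
        using K(1,2,3) K'(2,3) that by (intro add_mono mult_mono) auto
      finally show ?thesis by (simp add: algebra_simps)
    qed
  qed
qed

lemma bdd_lipschitz_mult:
  fixes f g :: "'a::metric_space \<Rightarrow> real"
  assumes "bdd_lipschitz S f" "bdd_lipschitz S g"
  shows "bdd_lipschitz S (\<lambda>x. f x * g x)"
  using bdd_lipschitz_scaleR[OF assms] by simp

lemma bdd_lipschitz_power2:
  fixes f :: "'a::metric_space \<Rightarrow> real"
  shows "bdd_lipschitz S f \<Longrightarrow> bdd_lipschitz S (\<lambda>x. (f x)\<^sup>2)"
  by (simp add: power2_eq_square bdd_lipschitz_mult)

lemma bdd_lipschitz_inverse:
  fixes f :: "'a::metric_space \<Rightarrow> real"
  assumes "bdd_lipschitz S f" "0 < c" "\<And>x. x \<in> S \<Longrightarrow> c \<le> f x"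
  shows "bdd_lipschitz S (\<lambda>x. inverse (f x))"
proof -
  obtain K where K: "0 < K" "\<And>x. x \<in> S \<Longrightarrow> norm (f x) \<le> K"
    "\<And>x y. x \<in> S \<Longrightarrow> y \<in> S \<Longrightarrow> norm (f x - f y) \<le> K * dist x y"
    using bdd_lipschitzE[OF assms(1)] by metis
  have inv: "inverse (f x) \<le> inverse c" "0 < inverse (f x)" if "x \<in> S" for x
    using assms(2) assms(3)[OF that] by (auto intro: le_imp_inverse_le)
  show ?thesis
  proof (rule bdd_lipschitzI)
    show "norm (inverse (f x)) \<le> inverse c" if "x \<in> S" for x
      using inv[OF that] by simp
    show "norm (inverse (f x) - inverse (f y)) \<le> (inverse c * inverse c * K) * dist x y"
      if "x \<in> S" "y \<in> S" for x y
    proof -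
      have "f x \<noteq> 0" "f y \<noteq> 0"
        using assms(2) assms(3)[OF that(1)] assms(3)[OF that(2)] by auto
      then have "inverse (f x) - inverse (f y) = inverse (f x) * inverse (f y) * (f y - f x)"
        by (simp add: field_simps)
      also have "norm \<dots> = inverse (f x) * inverse (f y) * norm (f y - f x)"
        using inv(2)[OF that(1)] inv(2)[OF that(2)] by (simp only: real_norm_def abs_mult abs_of_pos)
      also have "\<dots> \<le> (inverse c * inverse c) * (K * dist x y)"
        using inv[OF that(1)] inv[OF that(2)] K(3)[OF that(2,1)] assms(2)
        by (intro mult_mono) (auto simp: dist_commute)
      finally show ?thesis by (simp add: mult.assoc)
    qed
  qed
qed

lemma bdd_lipschitz_divide:
  fixes f g :: "'a::metric_space \<Rightarrow> real"
  assumes "bdd_lipschitz S f" "bdd_lipschitz S (\<lambda>x. inverse (g x))"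
  shows "bdd_lipschitz S (\<lambda>x. f x / g x)"
  using bdd_lipschitz_mult[OF assms] by (simp add: divide_inverse)

lemma bdd_lipschitz_Pair:
  assumes "bdd_lipschitz S f" "bdd_lipschitz S g"
  shows "bdd_lipschitz S (\<lambda>x. (f x, g x))"
proof -
  obtain K where K: "0 < K" "\<And>x. x \<in> S \<Longrightarrow> norm (f x) \<le> K"
    "\<And>x y. x \<in> S \<Longrightarrow> y \<in> S \<Longrightarrow> norm (f x - f y) \<le> K * dist x y"
    using bdd_lipschitzE[OF assms(1)] by metis
  obtain K' where K': "0 < K'" "\<And>x. x \<in> S \<Longrightarrow> norm (g x) \<le> K'"
    "\<And>x y. x \<in> S \<Longrightarrow> y \<in> S \<Longrightarrow> norm (g x - g y) \<le> K' * dist x y"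
    using bdd_lipschitzE[OF assms(2)] by metis
  show ?thesis
  proof (rule bdd_lipschitzI)
    show "norm (f x, g x) \<le> K + K'" if "x \<in> S" for x
      using norm_Pair_le[of "f x" "g x"] K(2)[OF that] K'(2)[OF that] by linarith
    show "norm ((f x, g x) - (f y, g y)) \<le> (K + K') * dist x y" if "x \<in> S" "y \<in> S" for x y
      using norm_Pair_le[of "f x - f y" "g x - g y"] K(3)[OF that] K'(3)[OF that]
      by (simp add: distrib_right)
  qed
qed

section \<open>Lipschitz bounds for trigonometric functions and from bounded derivatives\<close>

lemma lipschitz_sin: "1-lipschitz_on UNIV (sin :: real \<Rightarrow> real)"
proof (rule lipschitz_onI)
  fix x y :: real
  have "\<bar>sin x - sin y\<bar> = 2 * \<bar>sin ((x - y) / 2)\<bar> * \<bar>cos ((x + y) / 2)\<bar>"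
    by (simp add: sin_diff_sin abs_mult)
  also have "\<dots> \<le> 2 * \<bar>(x - y) / 2\<bar> * 1"
    by (intro mult_mono abs_sin_x_le_abs_x) auto
  finally show "dist (sin x) (sin y) \<le> 1 * dist x y"
    by (simp add: dist_real_def)
qed simp

lemma lipschitz_cos: "1-lipschitz_on UNIV (cos :: real \<Rightarrow> real)"
proof -
  have "1-lipschitz_on UNIV (\<lambda>x. pi / 2 - x :: real)"
    by (rule lipschitz_onI) (auto simp: dist_norm)
  then have "(1 * 1)-lipschitz_on UNIV (\<lambda>x. sin (pi / 2 - x :: real))"
    by (intro lipschitz_on_compose2 lipschitz_on_subset[OF lipschitz_sin]) auto
  then show ?thesis
    by (simp add: cos_sin_eq)
qed

lemma bdd_lipschitz_sin_cos:
  shows "bdd_lipschitz UNIV (sin :: real \<Rightarrow> real)" "bdd_lipschitz UNIV (cos :: real \<Rightarrow> real)"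
  unfolding bdd_lipschitz_def using lipschitz_sin lipschitz_cos by (intro exI[of _ 1]; simp)+

text \<open>Mean value inequality on a convex set. The hypothesis controls the derivative on basis
  vectors only, so its operator norm is bounded by the sum of the bounds in the basis
  directions.\<close>

lemma bounded_Ck_imp_bdd_lipschitz:
  fixes S :: "'a::euclidean_space set"
  assumes "bounded_Ck (Suc k) S f" "convex S"
  shows "bdd_lipschitz S f"
proof -
  obtain f' where f': "\<And>x. x \<in> S \<Longrightarrow> (f has_derivative f' x) (at x within S)"
    "\<And>i. i \<in> Basis \<Longrightarrow> bounded_Ck k S (\<lambda>x. f' x i)"
    using assms(1) by auto
  have "bounded ((\<lambda>x. f' x i) ` S)" if "i \<in> Basis" for i
    using f'(2)[OF that] by (cases k) auto
  then have "\<exists>b. \<forall>x\<in>S. \<bar>f' x i\<bar> \<le> b" if "i \<in> Basis" for i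
    using that by (auto simp: bounded_iff)
  then obtain b where b: "\<And>i x. i \<in> Basis \<Longrightarrow> x \<in> S \<Longrightarrow> \<bar>f' x i\<bar> \<le> b i"
    by metis
  obtain B where B: "\<And>x. x \<in> S \<Longrightarrow> \<bar>f x\<bar> \<le> B"
    using assms(1) by (auto simp: bounded_iff)
  have on: "onorm (f' x) \<le> (\<Sum>i\<in>Basis. b i)" if x: "x \<in> S" for x
  proof (rule onorm_le)
    fix v :: 'a
    interpret bounded_linear "f' x"
      using f'(1)[OF x] by (rule has_derivative_bounded_linear)
    have "f' x v = f' x (\<Sum>i\<in>Basis. (v \<bullet> i) *\<^sub>R i)"
      by (simp add: euclidean_representation)
    also have "\<dots> = (\<Sum>i\<in>Basis. (v \<bullet> i) * f' x i)"
      by (simp add: sum scaleR)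
    also have "norm \<dots> \<le> (\<Sum>i\<in>Basis. norm v * b i)"
      using b x by (intro sum_norm_le) (auto simp: abs_mult Basis_le_norm intro!: mult_mono)
    finally show "norm (f' x v) \<le> (\<Sum>i\<in>Basis. b i) * norm v"
      by (simp add: sum_distrib_left mult.commute)
  qed
  show ?thesis
    using differentiable_bound[OF assms(2) f'(1) on] B
    by (intro bdd_lipschitzI[where B = B and L = "\<Sum>i\<in>Basis. b i"]) (auto simp: dist_norm)
qed

lemma boundedly_smooth_imp_bdd_lipschitz:
  "boundedly_smooth S f \<Longrightarrow> convex S \<Longrightarrow> bdd_lipschitz S f"
  unfolding boundedly_smooth_def using bounded_Ck_imp_bdd_lipschitz by blast

lemma bounded_Ck_SucE:
  assumes "bounded_Ck (Suc k) S f"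
  obtains f' where "\<And>x. x \<in> S \<Longrightarrow> (f has_derivative f' x) (at x within S)"
    "\<And>i. i \<in> Basis \<Longrightarrow> bounded_Ck k S (\<lambda>x. f' x i)"
  using assms by auto

text \<open>\<open>dr\<close> and \<open>dtheta\<close> are one-variable derivatives; as
  \<open>S\<close> is open, they are the Frechet derivative applied to the basis vectors. Two orders
  of smoothness are used, one for the derivative to exist and one for it to be Lipschitz.\<close>

lemma boundedly_smooth_partial_derivatives:
  fixes g :: "real \<Rightarrow> real \<Rightarrow> real"
  assumes "boundedly_smooth S (\<lambda>(r, \<theta>). g r \<theta>)" "convex S" "open S"
  shows "bdd_lipschitz S (\<lambda>x. dr g (fst x) (snd x))"
    and "bdd_lipschitz S (\<lambda>x. dtheta g (fst x) (snd x))"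
proof -
  have "bounded_Ck (Suc (Suc 0)) S (\<lambda>(r, \<theta>). g r \<theta>)"
    using assms(1) unfolding boundedly_smooth_def by blast
  then obtain g' where g': "\<And>x. x \<in> S \<Longrightarrow> ((\<lambda>(r, \<theta>). g r \<theta>) has_derivative g' x) (at x within S)"
    "\<And>i. i \<in> Basis \<Longrightarrow> bounded_Ck (Suc 0) S (\<lambda>x. g' x i)"
    by (rule bounded_Ck_SucE) (rule that)
  have g'at: "((\<lambda>x. g (fst x) (snd x)) has_derivative g' x) (at x)" if "x \<in> S" for x
    using g'(1)[OF that] at_within_open[OF that assms(3)] by (simp only: case_prod_unfold)
  have lin: "linear (g' x)" if "x \<in> S" for x
    using g'at[OF that] by (rule has_derivative_linear)
  have "dr g (fst x) (snd x) = g' x (1, 0)" if x: "x \<in> S" for x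
  proof -
    have "((\<lambda>s. (s, snd x)) has_derivative (\<lambda>h. (h, 0))) (at (fst x))"
      by (intro has_derivative_Pair has_derivative_ident has_derivative_const)
    from has_derivative_compose[OF this, of "\<lambda>x. g (fst x) (snd x)" "g' x"] g'at[OF x]
    have "((\<lambda>s. g s (snd x)) has_derivative (\<lambda>h. g' x (h, 0))) (at (fst x))"
      by simp
    moreover have "(\<lambda>h. g' x (h, 0)) = (*) (g' x (1, 0))"
    proof
      show "g' x (h, 0) = g' x (1, 0) * h" for h
        using linear_scale[OF lin[OF x], of h "(1, 0)"] by (simp add: mult.commute)
    qed
    ultimately show ?thesis
      unfolding dr_def by (intro DERIV_imp_deriv) (simp add: has_field_derivative_def)
  qed
  moreover have "bdd_lipschitz S (\<lambda>x. g' x (1, 0))"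
    by (rule bounded_Ck_imp_bdd_lipschitz[OF g'(2) assms(2)]) (simp add: Basis_prod_def)
  ultimately show "bdd_lipschitz S (\<lambda>x. dr g (fst x) (snd x))"
    by (simp add: bdd_lipschitz_def)
  have "dtheta g (fst x) (snd x) = g' x (0, 1)" if x: "x \<in> S" for x
  proof -
    have "((\<lambda>s. (fst x, s)) has_derivative (\<lambda>h. (0, h))) (at (snd x))"
      by (intro has_derivative_Pair has_derivative_ident has_derivative_const)
    from has_derivative_compose[OF this, of "\<lambda>x. g (fst x) (snd x)" "g' x"] g'at[OF x]
    have "((\<lambda>s. g (fst x) s) has_derivative (\<lambda>h. g' x (0, h))) (at (snd x))"
      by simp
    moreover have "(\<lambda>h. g' x (0, h)) = (*) (g' x (0, 1))"
    proof
      show "g' x (0, h) = g' x (0, 1) * h" for h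
        using linear_scale[OF lin[OF x], of h "(0, 1)"] by (simp add: mult.commute)
    qed
    ultimately show ?thesis
      unfolding dtheta_def by (intro DERIV_imp_deriv) (simp add: has_field_derivative_def)
  qed
  moreover have "bdd_lipschitz S (\<lambda>x. g' x (0, 1))"
    by (rule bounded_Ck_imp_bdd_lipschitz[OF g'(2) assms(2)]) (simp add: Basis_prod_def)
  ultimately show "bdd_lipschitz S (\<lambda>x. dtheta g (fst x) (snd x))"
    by (simp add: bdd_lipschitz_def)
qed

lemma bdd_lipschitz_compose_sin_cos:
  fixes f :: "'a::metric_space \<Rightarrow> real"
  assumes "L-lipschitz_on S f"
  shows "bdd_lipschitz S (\<lambda>x. sin (f x))" "bdd_lipschitz S (\<lambda>x. cos (f x))"
  by (rule bdd_lipschitz_compose[OF _ assms, of UNIV], rule bdd_lipschitz_sin_cos, simp)+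

lemma bdd_lipschitz_imp_lipschitz_on:
  assumes "bdd_lipschitz S f"
  obtains L where "L-lipschitz_on S f"
  using assms unfolding bdd_lipschitz_def by blast

section \<open>Regularity of the fields\<close>

text \<open>The angles are lifted to the real line, so \<open>\<phi>\<close> and \<open>\<theta>\<close> stay unrestricted and a tube is not bounded.\<close>

definition tube :: "real \<Rightarrow> real \<Rightarrow> real \<Rightarrow> slow set" where
  "tube \<rho>1 \<rho>2 B = {Z. radius Z \<in> {\<rho>1..\<rho>2} \<and> \<bar>v_par Z\<bar> \<le> B \<and> \<bar>b_mu Z\<bar> \<le> B}"

locale toroidal_fields =
  fixes D :: toroidal_data
  assumes standing: "standing_assumptions D"
begin

lemma bfield_pos: "0 < r \<Longrightarrow> r < R0 D \<Longrightarrow> 0 < bfield D r \<theta>"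
  using standing unfolding standing_assumptions_def by blast

lemma bfield_smooth: "boundedly_smooth ({0<..<R0 D} \<times> UNIV) (\<lambda>(r, \<theta>). bfield D r \<theta>)"
  using standing unfolding standing_assumptions_def by blast

lemma omega_smooth: "boundedly_smooth ({0<..<R0 D} \<times> UNIV) (\<lambda>(r, \<theta>). omega D r \<theta>)"
  using standing unfolding standing_assumptions_def by blast

lemma E_smooth:
  assumes "E \<in> {E_r D, E_theta D, E_phi D}"
  shows "boundedly_smooth ({0..} \<times> {0<..<R0 D} \<times> UNIV \<times> UNIV) (\<lambda>(t, r, \<theta>, \<phi>). E t r \<theta> \<phi>)"
  using standing assms unfolding standing_assumptions_def by blast

lemma poloidal_domain: "convex ({0<..<R0 D} \<times> (UNIV :: real set))" "open ({0<..<R0 D} \<times> (UNIV :: real set))"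
  by (auto intro!: convex_Times open_Times)

lemma bfield_bdd_lipschitz:
  "bdd_lipschitz ({0<..<R0 D} \<times> UNIV) (\<lambda>x. bfield D (fst x) (snd x))"
  using boundedly_smooth_imp_bdd_lipschitz[OF bfield_smooth poloidal_domain(1)]
  by (simp add: case_prod_unfold)

text \<open>A positive continuous function attains its minimum on the compact product of the radius
  range with one period; the bound found there is carried to every angle by translation.\<close>

lemma bfield_bounded_below:
  assumes "0 < \<rho>1" "\<rho>2 < R0 D"
  obtains c where "0 < c" "\<And>r \<theta>. r \<in> {\<rho>1..\<rho>2} \<Longrightarrow> c \<le> bfield D r \<theta>"
proof (cases "\<rho>1 \<le> \<rho>2")
  case False
  then show thesis
    by (intro that[of 1]) auto
next
  case True
  let ?C = "{\<rho>1..\<rho>2} \<times> {0..2 * pi}"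
  obtain L where "L-lipschitz_on ({0<..<R0 D} \<times> UNIV) (\<lambda>x. bfield D (fst x) (snd x))"
    using bdd_lipschitz_imp_lipschitz_on[OF bfield_bdd_lipschitz] .
  then have "continuous_on ?C (\<lambda>x. bfield D (fst x) (snd x))"
    using assms by (intro continuous_on_subset[OF lipschitz_on_continuous_on]) auto
  then obtain x0 where x0: "x0 \<in> ?C"
    "\<And>x. x \<in> ?C \<Longrightarrow> bfield D (fst x0) (snd x0) \<le> bfield D (fst x) (snd x)"
    using continuous_attains_inf[of ?C] True by (force simp: compact_Times)
  show thesis
  proof (rule that)
    show "0 < bfield D (fst x0) (snd x0)"
      using x0(1) assms by (intro bfield_pos) auto
    fix r \<theta> assume r: "r \<in> {\<rho>1..\<rho>2}"
    interpret periodic_fun_simple "bfield D r" "2 * pi"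
      using standing r assms unfolding standing_assumptions_def by unfold_locales auto
    \<comment> \<open>The number of whole periods whose removal brings the angle into
      \<open>{0..2 * pi}\<close>.\<close>
    define k where "k = \<lfloor>\<theta> / (2 * pi)\<rfloor>"
    have "of_int k \<le> \<theta> / (2 * pi)" "\<theta> / (2 * pi) \<le> of_int k + 1"
      unfolding k_def by linarith+
    then have "\<theta> - of_int k * (2 * pi) \<in> {0..2 * pi}"
      by (simp add: field_simps)
    then show "bfield D (fst x0) (snd x0) \<le> bfield D r \<theta>"
      using x0(2)[of "(r, \<theta> - of_int k * (2 * pi))"] r minus_of_int[of \<theta> k] by simp
  qed
qed

end

text \<open>
  The coordinates \<open>x\<close>, \<open>y\<close> stand for \<open>u\<^sub>r\<close>, \<open>u\<^sub>\<bottom>\<close>.  Working with coordinate functions on an abstract metric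
  space lets the closure rules for sums, products and quotients apply to the fields verbatim.
\<close>

locale slow_fast_coordinates = toroidal_fields +
  fixes S :: "'x::metric_space set" and t r \<phi> \<theta> v w x y :: "'x \<Rightarrow> real" and \<rho>1 \<rho>2 :: real
  assumes radius_range: "0 < \<rho>1" "\<rho>2 < R0 D" "\<And>p. p \<in> S \<Longrightarrow> r p \<in> {\<rho>1..\<rho>2}"
    and time_nonneg: "\<And>p. p \<in> S \<Longrightarrow> 0 \<le> t p"
    and lip: "1-lipschitz_on S t" "1-lipschitz_on S r" "1-lipschitz_on S \<phi>" "1-lipschitz_on S \<theta>"
    and bl: "bdd_lipschitz S v" "bdd_lipschitz S w" "bdd_lipschitz S x" "bdd_lipschitz S y"
begin

lemma r_pos: "p \<in> S \<Longrightarrow> 0 < r p \<and> r p < R0 D"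
  using radius_range by force

text \<open>An angle is Lipschitz but unbounded, hence not \<open>bdd_lipschitz\<close>. The bound
  must come from the field itself, so the field is composed with the coordinates instead of being
  assembled by the closure rules.\<close>

lemma bl_poloidal:
  assumes "bdd_lipschitz ({0<..<R0 D} \<times> UNIV) (\<lambda>z. f (fst z) (snd z))"
  shows "bdd_lipschitz S (\<lambda>p. f (r p) (\<theta> p))"
proof -
  have "(\<lambda>p. (r p, \<theta> p)) ` S \<subseteq> {0<..<R0 D} \<times> UNIV"
    using r_pos by auto
  from bdd_lipschitz_compose[OF assms lipschitz_on_Pair[OF lip(2,4)] this] show ?thesis
    by simp
qed

lemma bl_electric:
  assumes "E \<in> {E_r D, E_theta D, E_phi D}"
  shows "bdd_lipschitz S (\<lambda>p. E (t p) (r p) (\<theta> p) (\<phi> p))"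
proof -
  have smooth: "bdd_lipschitz ({0..} \<times> {0<..<R0 D} \<times> UNIV \<times> UNIV) (\<lambda>(t, r, \<theta>, \<phi>). E t r \<theta> \<phi>)"
    by (intro boundedly_smooth_imp_bdd_lipschitz E_smooth assms convex_Times) auto
  have image: "(\<lambda>p. (t p, r p, \<theta> p, \<phi> p)) ` S \<subseteq> {0..} \<times> {0<..<R0 D} \<times> UNIV \<times> UNIV"
    using r_pos time_nonneg by auto
  \<comment> \<open>The electric field takes \<theta> before \<phi>, the reverse of the order in the
    slow variable, hence \<open>lip(4,3)\<close>.\<close>
  from bdd_lipschitz_compose[OF smooth lipschitz_on_Pair[OF lip(1) lipschitz_on_Pair[OF lip(2)
        lipschitz_on_Pair[OF lip(4,3)]]] image]
  show ?thesis
    by simp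
qed

lemma bl_b: "bdd_lipschitz S (\<lambda>p. bfield D (r p) (\<theta> p))"
  by (rule bl_poloidal) (rule bfield_bdd_lipschitz)

lemma bl_inverse_b: "bdd_lipschitz S (\<lambda>p. inverse (bfield D (r p) (\<theta> p)))"
proof -
  obtain c where "0 < c" "\<And>r \<theta>. r \<in> {\<rho>1..\<rho>2} \<Longrightarrow> c \<le> bfield D r \<theta>"
    using bfield_bounded_below[OF radius_range(1,2)] by blast
  then show ?thesis
    using radius_range(3) by (intro bdd_lipschitz_inverse[OF bl_b]) auto
qed

lemma bl_derivatives:
  "bdd_lipschitz S (\<lambda>p. dtheta (bfield D) (r p) (\<theta> p))"
  "bdd_lipschitz S (\<lambda>p. dr (bfield D) (r p) (\<theta> p))"
  "bdd_lipschitz S (\<lambda>p. dtheta (omega D) (r p) (\<theta> p))"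
  "bdd_lipschitz S (\<lambda>p. dr (omega D) (r p) (\<theta> p))"
  by (intro bl_poloidal boundedly_smooth_partial_derivatives bfield_smooth omega_smooth poloidal_domain)+

lemma bl_sin_cos:
  "bdd_lipschitz S (\<lambda>p. sin (\<theta> p))"
  "bdd_lipschitz S (\<lambda>p. cos (\<theta> p))"
  "bdd_lipschitz S (\<lambda>p. sin (omega D (r p) (\<theta> p)))"
  "bdd_lipschitz S (\<lambda>p. cos (omega D (r p) (\<theta> p)))"
proof -
  have "bdd_lipschitz ({0<..<R0 D} \<times> UNIV) (\<lambda>z. omega D (fst z) (snd z))"
    using boundedly_smooth_imp_bdd_lipschitz[OF omega_smooth poloidal_domain(1)]
    by (simp add: case_prod_unfold)
  then obtain L where L: "L-lipschitz_on S (\<lambda>p. omega D (r p) (\<theta> p))"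
    using bdd_lipschitz_imp_lipschitz_on[OF bl_poloidal] by blast
  show "bdd_lipschitz S (\<lambda>p. sin (\<theta> p))" "bdd_lipschitz S (\<lambda>p. cos (\<theta> p))"
    "bdd_lipschitz S (\<lambda>p. sin (omega D (r p) (\<theta> p)))"
    "bdd_lipschitz S (\<lambda>p. cos (omega D (r p) (\<theta> p)))"
    using bdd_lipschitz_compose_sin_cos[OF lip(4)] bdd_lipschitz_compose_sin_cos[OF L] by auto
qed

lemma bl_r: "bdd_lipschitz S r"
  using radius_range lip(2)
  by (intro bdd_lipschitzI[where B = \<rho>2 and L = 1]) (auto dest: lipschitz_onD simp: dist_norm, force)

lemma bl_inverse_r: "bdd_lipschitz S (\<lambda>p. inverse (r p))"
  using radius_range by (intro bdd_lipschitz_inverse[OF bl_r, of \<rho>1]) auto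

lemma bl_inverse_R: "bdd_lipschitz S (\<lambda>p. inverse (RR D (r p) (\<theta> p)))"
proof (rule bdd_lipschitz_inverse)
  show "bdd_lipschitz S (\<lambda>p. RR D (r p) (\<theta> p))"
    unfolding RR_def
    by (intro bdd_lipschitz_add bdd_lipschitz_mult bdd_lipschitz_const bl_r bl_sin_cos)
  show "0 < R0 D - \<rho>2"
    using radius_range by simp
  fix p assume p: "p \<in> S"
  have "r p * (- 1) \<le> r p * cos (\<theta> p)"
    using r_pos[OF p] by (intro mult_left_mono) auto
  then show "R0 D - \<rho>2 \<le> RR D (r p) (\<theta> p)"
    using radius_range(3)[OF p] by (simp add: RR_def)
qed

lemmas bl_intros =
  bdd_lipschitz_const bdd_lipschitz_minus bdd_lipschitz_add bdd_lipschitz_diff bdd_lipschitz_mult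
  bdd_lipschitz_power2 bdd_lipschitz_divide bdd_lipschitz_Pair
  bl bl_b bl_inverse_b bl_derivatives bl_sin_cos bl_r bl_inverse_r bl_inverse_R

lemma bl_coefficients:
  "bdd_lipschitz S (\<lambda>p. c_alpha D (r p) (\<theta> p))"
  "bdd_lipschitz S (\<lambda>p. c_beta D (r p) (\<theta> p))"
  "bdd_lipschitz S (\<lambda>p. c_gamma D (r p) (\<theta> p))"
  "bdd_lipschitz S (\<lambda>p. c_delta D (r p) (\<theta> p))"
  "bdd_lipschitz S (\<lambda>p. c_zeta D (r p) (\<theta> p))"
  "bdd_lipschitz S (\<lambda>p. c_eta D (r p) (\<theta> p))"
  "bdd_lipschitz S (\<lambda>p. c_kappa D (r p) (\<theta> p))"
  "bdd_lipschitz S (\<lambda>p. c_lambda D (r p) (\<theta> p))"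
  unfolding c_alpha_def c_beta_def c_gamma_def c_delta_def c_zeta_def c_eta_def c_kappa_def
    c_lambda_def
  by (intro bl_intros)+

lemma bl_E_par_perp:
  "bdd_lipschitz S (\<lambda>p. E_par D (t p) (r p) (\<theta> p) (\<phi> p))"
  "bdd_lipschitz S (\<lambda>p. E_perp D (t p) (r p) (\<theta> p) (\<phi> p))"
  unfolding E_par_def E_perp_def by (intro bl_intros bl_electric; simp)+

lemma bl_F_par:
  "bdd_lipschitz S (\<lambda>p. F_par D (r p, \<phi> p, \<theta> p, v p, w p) (x p, y p))"
  unfolding F_par.simps Let_def
  by (intro bl_intros bl_coefficients)

lemma bl_F:
  "bdd_lipschitz S (\<lambda>p. F D (t p) (r p, \<phi> p, \<theta> p, v p, w p) (x p, y p))"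
  unfolding F.simps Let_def
  by (intro bl_intros bl_coefficients bl_F_par bl_E_par_perp bl_electric; simp)

lemma bl_U_perp:
  "bdd_lipschitz S (\<lambda>p. U_perp D (t p) (r p, \<phi> p, \<theta> p, v p, w p) (x p, y p))"
  unfolding U_perp.simps Let_def
  by (intro bl_intros bl_coefficients bl_E_par_perp bl_electric; simp)

end

section \<open>Joint estimates in time, slow variable and fast variable on tubes\<close>

lemma lipschitz_on_fst_snd:
  assumes "1-lipschitz_on S f"
  shows "1-lipschitz_on S (\<lambda>p. fst (f p))" "1-lipschitz_on S (\<lambda>p. snd (f p))"
  using order_trans[OF dist_fst_le lipschitz_onD[OF assms]] order_trans[OF dist_snd_le lipschitz_onD[OF assms]]
  by (auto intro!: lipschitz_onI)

lemma bdd_lipschitz_coordinate: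
  fixes f :: "'a::metric_space \<Rightarrow> real"
  assumes "1-lipschitz_on S f" "\<And>p. p \<in> S \<Longrightarrow> \<bar>f p\<bar> \<le> B"
  shows "bdd_lipschitz S f"
  using assms lipschitz_onD[OF assms(1)]
  by (intro bdd_lipschitzI[where B = B and L = 1]) (auto simp: dist_norm)

lemma slow_component_bounds:
  "\<bar>radius Z\<bar> \<le> norm Z" "\<bar>v_par Z\<bar> \<le> norm Z" "\<bar>b_mu Z\<bar> \<le> norm Z"
proof -
  have fs: "norm (fst p) \<le> norm p" "norm (snd p) \<le> norm p" for p :: "'c::real_normed_vector \<times> 'd::real_normed_vector"
    using norm_fst_le[of "fst p" "snd p"] norm_snd_le[of "snd p" "fst p"] by auto
  obtain r \<phi> \<theta> v w where Z: "Z = (r, \<phi>, \<theta>, v, w)"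
    by (metis prod.exhaust)
  have "norm (v, w) \<le> norm Z"
    unfolding Z by (meson norm_snd_le order_trans)
  then show "\<bar>radius Z\<bar> \<le> norm Z" "\<bar>v_par Z\<bar> \<le> norm Z" "\<bar>b_mu Z\<bar> \<le> norm Z"
    using norm_fst_le[of v w] norm_snd_le[of w v] norm_fst_le[of r "(\<phi>, \<theta>, v, w)"]
    by (auto simp: Z)
qed

lemma slow_component_diff:
  "radius (Z - W) = radius Z - radius W"
  "v_par (Z - W) = v_par Z - v_par W"
  "b_mu (Z - W) = b_mu Z - b_mu W"
  by (cases Z; cases W; force)+

lemma radius_add_scaleR:
  "radius (Z + c *\<^sub>R W) = radius Z + c * radius W"
  by (cases Z; cases W; force)+

lemma b_at_eq: "b_at D Z = bfield D (fst Z) (fst (snd (snd Z)))"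
  by (cases Z) auto

lemma tube_enlarge:
  assumes "W \<in> tube \<rho>1 \<rho>2 B" "norm (Z - W) \<le> d"
  shows "Z \<in> tube (\<rho>1 - d) (\<rho>2 + d) (B + d)"
  using assms slow_component_bounds[of "Z - W"]
  unfolding tube_def slow_component_diff by auto

lemma tube_mono: "\<rho>1' \<le> \<rho>1 \<Longrightarrow> \<rho>2 \<le> \<rho>2' \<Longrightarrow> B \<le> B' \<Longrightarrow> tube \<rho>1 \<rho>2 B \<subseteq> tube \<rho>1' \<rho>2' B'"
  unfolding tube_def by auto

context toroidal_fields
begin

text \<open>Realises the abstract coordinates as the projections of a product set, so that the
  closure results become joint bounds in time, \<open>Z\<close> and \<open>u\<close>.\<close>

lemma slow_fast_coordinates_product:
  assumes "0 < \<rho>1" "\<rho>2 < R0 D"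
  shows "slow_fast_coordinates D ({0..} \<times> tube \<rho>1 \<rho>2 B \<times> cball 0 B') fst
    (\<lambda>p. fst (fst (snd p))) (\<lambda>p. fst (snd (fst (snd p)))) (\<lambda>p. fst (snd (snd (fst (snd p)))))
    (\<lambda>p. fst (snd (snd (snd (fst (snd p)))))) (\<lambda>p. snd (snd (snd (snd (fst (snd p))))))
    (\<lambda>p. fst (snd (snd p))) (\<lambda>p. snd (snd (snd p))) \<rho>1 \<rho>2"
proof -
  let ?S = "{0..} \<times> tube \<rho>1 \<rho>2 B \<times> cball (0 :: fast) B'"
  note lips = lipschitz_on_fst_snd lipschitz_on_id
  have u: "\<bar>fst u\<bar> \<le> B'" "\<bar>snd u\<bar> \<le> B'" if "norm u \<le> B'" for u :: fast
    using norm_fst_le[of "fst u" "snd u"] norm_snd_le[of "snd u" "fst u"] that by auto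
  show ?thesis
  proof unfold_locales
    show "bdd_lipschitz ?S (\<lambda>p. fst (snd (snd (snd (fst (snd p))))))"
      "bdd_lipschitz ?S (\<lambda>p. snd (snd (snd (snd (fst (snd p))))))"
      by (intro bdd_lipschitz_coordinate[where B = B] lips; auto simp: tube_def)+
    show "bdd_lipschitz ?S (\<lambda>p. fst (snd (snd p)))" "bdd_lipschitz ?S (\<lambda>p. snd (snd (snd p)))"
      by (intro bdd_lipschitz_coordinate[where B = B'] lips; use u in auto)+
  qed (use assms in \<open>auto intro!: lips simp: tube_def\<close>)
qed

lemma F_bdd_lipschitz:
  assumes "0 < \<rho>1" "\<rho>2 < R0 D"
  shows "bdd_lipschitz ({0..} \<times> tube \<rho>1 \<rho>2 B \<times> cball 0 B') (\<lambda>(t, Z, u). F D t Z u)"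
  using slow_fast_coordinates.bl_F[OF slow_fast_coordinates_product[OF assms]]
  by (simp add: case_prod_unfold)

lemma U_perp_bdd_lipschitz:
  assumes "0 < \<rho>1" "\<rho>2 < R0 D"
  shows "bdd_lipschitz ({0..} \<times> tube \<rho>1 \<rho>2 B \<times> cball 0 B') (\<lambda>(t, Z, u). U_perp D t Z u)"
  using slow_fast_coordinates.bl_U_perp[OF slow_fast_coordinates_product[OF assms]]
  by (simp add: case_prod_unfold)

lemma b_at_bounded_below:
  assumes "0 < \<rho>1" "\<rho>2 < R0 D"
  obtains c where "0 < c" "\<And>B Z. Z \<in> tube \<rho>1 \<rho>2 B \<Longrightarrow> c \<le> b_at D Z"
proof -
  obtain c where c: "0 < c" "\<And>r \<theta>. r \<in> {\<rho>1..\<rho>2} \<Longrightarrow> c \<le> bfield D r \<theta>"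
    using bfield_bounded_below[OF assms] by blast
  show thesis
    by (rule that[of c]) (use c in \<open>auto simp: tube_def\<close>)
qed

lemma slaved_velocity_bdd_lipschitz:
  assumes "0 < \<rho>1" "\<rho>2 < R0 D"
  shows "bdd_lipschitz ({0..} \<times> tube \<rho>1 \<rho>2 B) (\<lambda>(t, Z). slaved_velocity D \<epsilon> t Z)"
proof -
  \<comment> \<open>\<open>cball 0 0\<close> is the singleton of 0: since \<open>Ubar\<close> is
    \<open>U_perp\<close> at \<open>u = 0\<close>, the joint estimate with a fast ball of radius
    zero applies.\<close>
  let ?S = "{0..} \<times> tube \<rho>1 \<rho>2 B \<times> cball 0 0"
  have emb: "1-lipschitz_on ({0..} \<times> tube \<rho>1 \<rho>2 B) (\<lambda>p. (fst p, snd p, 0::fast))"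
    by (rule lipschitz_onI) (auto simp: dist_Pair_Pair)
  have "bdd_lipschitz ?S (\<lambda>p. inverse (b_at D (fst (snd p))) *\<^sub>R U_perp D (fst p) (fst (snd p)) (snd (snd p)))"
    using bdd_lipschitz_scaleR[OF slow_fast_coordinates.bl_inverse_b[OF slow_fast_coordinates_product[OF assms]]
       U_perp_bdd_lipschitz[OF assms, of B 0]]
    by (simp add: case_prod_unfold b_at_eq)
  then have "bdd_lipschitz ?S (\<lambda>p. \<epsilon> *\<^sub>R (inverse (b_at D (fst (snd p))) *\<^sub>R U_perp D (fst p) (fst (snd p)) (snd (snd p))))"
    by (rule bdd_lipschitz_scaleR[OF bdd_lipschitz_const])
  moreover have "(\<lambda>p. (fst p, snd p, 0::fast)) ` ({0..} \<times> tube \<rho>1 \<rho>2 B) \<subseteq> ?S"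
    by auto
  note bdd_lipschitz_compose[OF calculation(1) emb this]
  then show ?thesis
    by (simp add: slaved_velocity_def Ubar_def case_prod_unfold divide_inverse)
qed

lemma gyrokinetic_field_bdd_lipschitz:
  assumes "0 < \<rho>1" "\<rho>2 < R0 D"
  shows "bdd_lipschitz ({0..} \<times> tube \<rho>1 \<rho>2 B) (\<lambda>(t, Z). gyrokinetic_field D t Z)"
proof -
  have emb: "1-lipschitz_on ({0..} \<times> tube \<rho>1 \<rho>2 B) (\<lambda>p. (fst p, snd p, 0::fast))"
    by (rule lipschitz_onI) (auto simp: dist_Pair_Pair)
  have "(\<lambda>p. (fst p, snd p, 0::fast)) ` ({0..} \<times> tube \<rho>1 \<rho>2 B) \<subseteq> {0..} \<times> tube \<rho>1 \<rho>2 B \<times> cball 0 0"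
    by auto
  from bdd_lipschitz_compose[OF F_bdd_lipschitz[OF assms] emb this]
  show ?thesis
    by (simp add: gyrokinetic_field_def case_prod_unfold)
qed

lemma corrected_field_bdd_lipschitz:
  assumes "0 < \<rho>1" "\<rho>2 < R0 D"
  shows "bdd_lipschitz ({0..} \<times> tube \<rho>1 \<rho>2 B) (\<lambda>(t, Z). corrected_field D \<epsilon> t Z)"
proof -
  let ?s = "\<lambda>(t, Z). slaved_velocity D \<epsilon> t Z"
  obtain K where K: "\<forall>p\<in>{0..} \<times> tube \<rho>1 \<rho>2 B. norm (?s p) \<le> K" "K-lipschitz_on ({0..} \<times> tube \<rho>1 \<rho>2 B) ?s"
    using slaved_velocity_bdd_lipschitz[OF assms] unfolding bdd_lipschitz_def by blast
  have "1-lipschitz_on ({0..} \<times> tube \<rho>1 \<rho>2 B) fst" "1-lipschitz_on ({0..} \<times> tube \<rho>1 \<rho>2 B) snd"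
    by (intro lipschitz_on_fst_snd lipschitz_on_id)+
  note emb = lipschitz_on_Pair[OF this(1) lipschitz_on_Pair[OF this(2) K(2)]]
  \<comment> \<open>The bound \<open>K\<close> on the slaved velocity serves as the radius of the
    fast ball.\<close>
  have "(\<lambda>p. (fst p, snd p, ?s p)) ` ({0..} \<times> tube \<rho>1 \<rho>2 B) \<subseteq> {0..} \<times> tube \<rho>1 \<rho>2 B \<times> cball 0 K"
    using K(1) by auto
  from bdd_lipschitz_compose[OF F_bdd_lipschitz[OF assms] emb this]
  show ?thesis
    by (simp add: corrected_field_def case_prod_unfold)
qed

end

text \<open>The radial component of \<open>F\<close> is \<open>b * ur\<close>, which vanishes at
  \<open>u = 0\<close>. Hence the limiting scheme conserves the radius exactly, and its tube keeps
  the same radius range for all steps.\<close>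

lemma gyrokinetic_field_radius: "radius (gyrokinetic_field D t Z) = 0"
  by (cases Z) (simp add: gyrokinetic_field_def zero_prod_def Let_def)

text \<open>\<open>U_perp\<close> is quadratic in \<open>u\<close>; its linear and quadratic parts are read off from the values at \<open>u\<close> and \<open>- u\<close>.\<close>

lemma U_perp_scaleR:
  "U_perp D t Z (s *\<^sub>R u) = U_perp D t Z 0 + (s / 2) *\<^sub>R (U_perp D t Z u - U_perp D t Z (- u))
     + s\<^sup>2 *\<^sub>R ((1 / 2) *\<^sub>R (U_perp D t Z u + U_perp D t Z (- u)) - U_perp D t Z 0)"
  by (cases Z; cases u) (simp add: zero_prod_def Let_def power2_eq_square field_simps)

section \<open>The implicit step\<close>

lemma norm_J0: "norm (J0 x) = norm x"
  by (cases x) (simp add: norm_Pair add.commute)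

lemma inner_J0: "inner x (J0 x) = 0"
  by (cases x) (simp add: algebra_simps)

lemma J0_diff: "J0 (x - y) = J0 x - J0 y"
  by (cases x; cases y) simp

lemma J0_scaleR: "J0 (c *\<^sub>R x) = c *\<^sub>R J0 x"
  by (cases x) simp

text \<open>Pairing the relation with \<open>u'\<close> removes the term \<open>J0 u' / h\<close> by
  skew symmetry and leaves \<open>c\<close> times the squared norm against the data. With c =
  b/\<epsilon> the result is O(\<epsilon>).\<close>

lemma implicit_step_norm_le:
  assumes "J0 ((u' - u) /\<^sub>R h) = U - c *\<^sub>R u'" "0 < c" "0 < h"
  shows "norm u' \<le> (norm u / h + norm U) / c"
proof (cases "u' = 0")
  case False
  have "c *\<^sub>R u' = U + J0 u /\<^sub>R h - J0 u' /\<^sub>R h"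
    using assms(1) by (simp add: J0_scaleR J0_diff algebra_simps)
  then have "c * (norm u')\<^sup>2 = inner u' (U + J0 u /\<^sub>R h - J0 u' /\<^sub>R h)"
    by (metis inner_scaleR_right power2_norm_eq_inner)
  also have "\<dots> = inner u' (U + J0 u /\<^sub>R h)"
    by (simp add: inner_diff_right inner_J0)
  also have "\<dots> \<le> norm u' * norm (U + J0 u /\<^sub>R h)"
    by (rule norm_cauchy_schwarz)
  also have "\<dots> \<le> norm u' * (norm U + norm u / h)"
    using assms(3) by (intro mult_left_mono norm_triangle_le) (auto simp: norm_J0 divide_inverse mult.commute)
  finally have "norm u' * (c * norm u') \<le> norm u' * (norm U + norm u / h)"
    by (simp add: power2_eq_square mult_ac)
  then have "c * norm u' \<le> norm U + norm u / h"
    using False by simp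
  then show ?thesis
    using assms(2) by (simp add: field_simps)
qed (use assms in simp)

text \<open>The deviation from the balance \<open>c u' = U\<close> is exactly the rotated time
  difference. With c = b/\<epsilon> it gains a factor \<epsilon> over the size of
  \<open>u' - u\<close>, which is where second order comes from.\<close>

lemma implicit_step_expansion:
  assumes "J0 ((u' - u) /\<^sub>R h) = U - c *\<^sub>R u'" "0 < c" "0 < h"
  shows "norm (u' - U /\<^sub>R c) = norm (u' - u) / (h * c)"
proof -
  have "c *\<^sub>R u' - U = - (J0 (u' - u) /\<^sub>R h)"
    using assms(1) by (simp add: J0_scaleR)
  then have "inverse c *\<^sub>R (c *\<^sub>R u' - U) = - (J0 (u' - u) /\<^sub>R h) /\<^sub>R c"
    by simp
  then have "u' - U /\<^sub>R c = - (J0 (u' - u) /\<^sub>R h) /\<^sub>R c"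
    using assms(2) by (simp add: scaleR_diff_right)
  then show ?thesis
    using assms(2,3) by (simp add: norm_J0 divide_inverse mult_ac)
qed

section \<open>Consistency of the Euler scheme\<close>

lemma num_steps_le:
  assumes "0 < h" "n \<le> num_steps T h" "0 < T"
  shows "real n * h \<le> T"
proof -
  have "real n \<le> T / h"
    using assms unfolding num_steps_def by (simp add: le_nat_iff le_floor_iff)
  then show ?thesis
    using assms(1) by (simp add: field_simps)
qed

text \<open>The distance \<open>d\<close> of the arguments is kept apart from the error
  \<open>e\<close> of the states, because the increments may differ through the fast variable as
  well.\<close>

lemma norm_euler_step_diff_le:
  fixes x :: "'a::real_normed_vector"
  assumes "0 \<le> h" "0 \<le> K" "norm (f - f') \<le> K * d" "norm (x - x') \<le> e"
  shows "norm ((x + h *\<^sub>R f) - (x' + h *\<^sub>R f')) \<le> e + h * K * d"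
proof -
  have "(x + h *\<^sub>R f) - (x' + h *\<^sub>R f') = (x - x') + h *\<^sub>R (f - f')"
    by (simp add: algebra_simps)
  also have "norm \<dots> \<le> norm (x - x') + h * norm (f - f')"
    using assms(1) by (intro norm_triangle_le) simp
  also have "\<dots> \<le> e + h * (K * d)"
    using assms by (intro add_mono mult_left_mono)
  finally show ?thesis by (simp add: mult.assoc)
qed

lemma euler_step_eq:
  fixes x x' f :: "'a::real_vector"
  assumes "0 < h" "(x' - x) /\<^sub>R h = f"
  shows "x' = x + h *\<^sub>R f"
  using assms by (auto simp: scaleR_diff_right)

text \<open>Convergence of explicit Euler when the Lipschitz bound holds only on compact sets: the
  numerical sequence must be shown to stay near the exact trajectory while its error is being
  estimated.\<close>

lemma lipschitz_imp_consistent_first_order: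
  fixes \<Phi> :: "real \<Rightarrow> 'a::euclidean_space \<Rightarrow> 'a"
  assumes "open S" "0 < T"
    and bl: "\<And>K. compact K \<Longrightarrow> K \<subseteq> S \<Longrightarrow> bdd_lipschitz ({0..} \<times> K) (\<lambda>(t, z). \<Phi> t z)"
  shows "consistent_first_order T S \<Phi> \<Phi>"
  unfolding consistent_first_order_def
proof (intro allI impI)
  fix z assume "solves_on T S \<Phi> z"
  then have z: "\<And>t. t \<in> {0..T} \<Longrightarrow> z t \<in> S"
    and z': "\<And>t. t \<in> {0..T} \<Longrightarrow> (z has_vector_derivative \<Phi> t (z t)) (at t within {0..T})"
    unfolding solves_on_def by auto
  have "continuous_on {0..T} z"
    using z' by (meson has_vector_derivative_continuous continuous_on_eq_continuous_within)
  then have "compact (z ` {0..T})"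
    by (intro compact_continuous_image) auto
  moreover have "z ` {0..T} \<subseteq> S"
    using z by auto
  \<comment> \<open>The numerical points leave the trajectory, so bounds are taken on a closed
    neighbourhood of it that is compact and still inside \<open>S\<close>.\<close>
  ultimately obtain \<delta> where \<delta>: "0 < \<delta>" "(\<Union>x\<in>z ` {0..T}. cball x \<delta>) \<subseteq> S"
    using compact_subset_open_imp_cball_epsilon_subset[OF _ assms(1)] by metis
  define K where "K = (\<Union>x\<in>z ` {0..T}. cball x \<delta>)"
  have "compact K"
    unfolding K_def by (rule compact_minkowski_sum_cball) fact
  then obtain L where L: "0 < L"
    and bound: "\<And>p. p \<in> {0..} \<times> K \<Longrightarrow> norm ((\<lambda>(t, z). \<Phi> t z) p) \<le> L"
    and lip: "\<And>p q. p \<in> {0..} \<times> K \<Longrightarrow> q \<in> {0..} \<times> K \<Longrightarrow>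
      norm ((\<lambda>(t, z). \<Phi> t z) p - (\<lambda>(t, z). \<Phi> t z) q) \<le> L * dist p q"
    using bdd_lipschitzE[OF bl] \<delta>(2) unfolding K_def by metis
  have zK: "z t \<in> K" if "t \<in> {0..T}" for t
    using that \<delta>(1) unfolding K_def by force
  have z_lip: "norm (z t - z s) \<le> L * \<bar>t - s\<bar>" if "t \<in> {0..T}" "s \<in> {0..T}" for s t
  proof -
    have "norm (z t - z s) \<le> L * norm (t - s)"
    proof (rule differentiable_bound[of "{0..T}" z "\<lambda>t x. x *\<^sub>R \<Phi> t (z t)" L t s])
      fix x assume x: "x \<in> {0..T}"
      show "onorm (\<lambda>y. y *\<^sub>R \<Phi> x (z x)) \<le> L"
        using bound[of "(x, z x)"] x zK[OF x]
        by (intro onorm_le) (simp add: mult.commute[of L] mult_left_mono)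
    qed (use that z' in \<open>auto simp: has_vector_derivative_def\<close>)
    then show ?thesis
      by simp
  qed
  \<comment> \<open>A Lipschitz constant of \<open>\<Phi>\<close> along the solution:
    \<open>L\<close> times the speed of the curve (t, z t), which is at most 1 + L. It stands in for
    a bound on the second derivative of \<open>z\<close>.\<close>
  define \<tau> where "\<tau> = L * (1 + L)"
  have \<tau>: "0 < \<tau>"
    using L by (simp add: \<tau>_def)
  have truncation: "norm (z (s + h) - (z s + h *\<^sub>R \<Phi> s (z s))) \<le> \<tau> * h\<^sup>2"
    if "0 \<le> s" "0 < h" "s + h \<le> T" for s h
  proof -
    have "norm (z (s + h) - z s - (s + h - s) *\<^sub>R \<Phi> s (z s)) \<le> norm (s + h - s) * (\<tau> * h)"
    proof (rule vector_differentiable_bound_linearization[of "{s..s + h}"])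
      fix x assume x: "x \<in> {s..s + h}"
      then have x': "x \<in> {0..T}" "s \<in> {0..T}"
        using that by auto
      show "(z has_vector_derivative \<Phi> x (z x)) (at x within {s..s + h})"
        using z'[OF x'(1)] that by (rule_tac has_vector_derivative_within_subset) auto
      have "norm (\<Phi> x (z x) - \<Phi> s (z s)) \<le> L * dist (x, z x) (s, z s)"
        using lip[of "(x, z x)" "(s, z s)"] x' zK by auto
      also have "\<dots> \<le> L * (\<bar>x - s\<bar> + L * \<bar>x - s\<bar>)"
        using L z_lip[OF x'] norm_Pair_le[of "x - s" "z x - z s"]
        by (intro mult_left_mono) (auto simp: dist_norm)
      also have "\<dots> = \<tau> * (x - s)"
        using x by (simp add: \<tau>_def algebra_simps)
      also have "\<dots> \<le> \<tau> * h"
        using \<tau> x by (intro mult_left_mono) auto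
      finally show "norm (\<Phi> x (z x) - \<Phi> s (z s)) \<le> \<tau> * h" .
    qed (use that in \<open>auto simp: closed_segment_eq_real_ivl\<close>)
    then show ?thesis
      using that(2) by (simp add: power2_eq_square algebra_simps)
  qed
  have grid: "0 \<le> real n * h" "real n * h + h \<le> T" "real (Suc n) * h = real n * h + h"
    if "0 < h" "n < num_steps T h" for n h
    using num_steps_le[OF that(1) _ assms(2), of "Suc n"] that by (auto simp: algebra_simps)
  show "(\<exists>C. \<forall>h>0. \<forall>n<num_steps T h.
        norm ((z (real (Suc n) * h) - z (real n * h)) /\<^sub>R h - \<Phi> (real n * h) (z (real n * h)))
          \<le> C * h) \<and>
     (\<exists>C. \<exists>h0>0. \<forall>h m W. 0 < h \<and> h \<le> h0 \<and> W m = z (real m * h) \<and>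
          one_step_scheme h m (num_steps T h) \<Phi> W \<longrightarrow>
        (\<forall>n\<in>{m..num_steps T h}. norm (W n - z (real n * h)) \<le> C * h))"
  proof (intro conjI)
    show "\<exists>C. \<forall>h>0. \<forall>n<num_steps T h.
        norm ((z (real (Suc n) * h) - z (real n * h)) /\<^sub>R h - \<Phi> (real n * h) (z (real n * h)))
          \<le> C * h"
    proof (intro exI[of _ \<tau>] allI impI)
      fix h :: real and n assume h: "0 < h" and n: "n < num_steps T h"
      let ?s = "real n * h"
      have "(z (?s + h) - z ?s) /\<^sub>R h - \<Phi> ?s (z ?s) = (z (?s + h) - (z ?s + h *\<^sub>R \<Phi> ?s (z ?s))) /\<^sub>R h"
        using h by (simp add: scaleR_diff_right scaleR_add_right)
      also have "norm \<dots> \<le> (\<tau> * h\<^sup>2) / h"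
        using truncation[OF grid(1)[OF h n] h grid(2)[OF h n]] h
        by (simp add: divide_inverse mult.commute mult_left_mono)
      finally show "norm ((z (real (Suc n) * h) - z ?s) /\<^sub>R h - \<Phi> ?s (z ?s)) \<le> \<tau> * h"
        using h unfolding grid(3)[OF h n] by (simp add: power2_eq_square)
    qed
    \<comment> \<open>Gronwall constant: at most T/h local errors, each of size \<tau> times the
      square of h, each amplified by at most \<open>exp (L * T)\<close>.\<close>
    define C where "C = \<tau> * T * exp (L * T)"
    have C: "0 < C"
      using \<tau> assms(2) by (simp add: C_def)
    show "\<exists>C. \<exists>h0>0. \<forall>h m W. 0 < h \<and> h \<le> h0 \<and> W m = z (real m * h) \<and>
          one_step_scheme h m (num_steps T h) \<Phi> W \<longrightarrow>
        (\<forall>n\<in>{m..num_steps T h}. norm (W n - z (real n * h)) \<le> C * h)"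
    \<comment> \<open>With h at most \<delta>/C the global bound \<open>C * h\<close> is at most
      \<delta>, so the induction below cannot leave \<open>K\<close>.\<close>
    proof (rule exI[of _ C], rule exI[of _ "\<delta> / C"], intro conjI allI impI ballI)
      show "0 < \<delta> / C"
        using \<delta> C by simp
      fix h m W n
      assume "0 < h \<and> h \<le> \<delta> / C \<and> W m = z (real m * h) \<and> one_step_scheme h m (num_steps T h) \<Phi> W"
      then have h: "0 < h" "C * h \<le> \<delta>" and W0: "W m = z (real m * h)"
        and W: "\<And>n. m \<le> n \<Longrightarrow> n < num_steps T h \<Longrightarrow> (W (Suc n) - W n) /\<^sub>R h = \<Phi> (real n * h) (W n)"
        using C by (auto simp: one_step_scheme_def field_simps)
      have le_C: "\<tau> * h * (real k * h) * (1 + h * L) ^ k \<le> C * h" if "k \<le> num_steps T h" for k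
      proof -
        have T: "real k * h \<le> T"
          using num_steps_le[OF h(1) that assms(2)] .
        have "(1 + h * L) ^ k \<le> exp (h * L) ^ k"
          using L h by (intro power_mono) (auto simp: exp_ge_add_one_self)
        also have "\<dots> = exp (L * (real k * h))"
          by (simp add: exp_of_nat_mult[symmetric] mult_ac)
        also have "\<dots> \<le> exp (L * T)"
          using T L by simp
        finally have "(\<tau> * h) * (real k * h * (1 + h * L) ^ k) \<le> (\<tau> * h) * (T * exp (L * T))"
          using T \<tau> h L assms(2) by (intro mult_left_mono mult_mono) auto
        then show ?thesis
          by (simp add: C_def mult_ac)
      qed
      \<comment> \<open>The factor \<open>k\<close> counts the local errors made so far and the
        power their amplification; this form reproduces itself under one Euler step.\<close>
      have err: "norm (W (m + k) - z (real (m + k) * h)) \<le> \<tau> * h * (real k * h) * (1 + h * L) ^ k"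
        if "m + k \<le> num_steps T h" for k
        using that
      proof (induction k)
        case (Suc k)
        let ?n = "m + k" and ?e = "\<tau> * h * (real k * h) * (1 + h * L) ^ k"
        let ?s = "real ?n * h"
        have n: "?n < num_steps T h"
          using Suc.prems by simp
        have IH: "norm (W ?n - z ?s) \<le> ?e"
          using Suc by simp
        have s: "?s \<in> {0..T}"
          using grid[OF h(1) n] h by auto
        \<comment> \<open>Bootstrap: the error bound at the current index places \<open>W ?n\<close>
          in \<open>K\<close>, where the Lipschitz bound for the next step is valid.\<close>
        have "?e \<le> \<delta>"
          using le_C[of k] n h(2) by linarith
        then have WK: "W ?n \<in> K"
          using IH s unfolding K_def by (auto simp: dist_norm norm_minus_commute intro!: bexI[of _ ?s])
        have "norm (\<Phi> ?s (W ?n) - \<Phi> ?s (z ?s)) \<le> L * norm (W ?n - z ?s)"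
          using lip[of "(?s, W ?n)" "(?s, z ?s)"] s WK zK[OF s] by (simp add: dist_Pair_Pair dist_norm)
        also have "\<dots> \<le> L * ?e"
          using IH L by (intro mult_left_mono) auto
        finally have "norm ((W ?n + h *\<^sub>R \<Phi> ?s (W ?n)) - (z ?s + h *\<^sub>R \<Phi> ?s (z ?s))) \<le> ?e + h * L * ?e"
          using norm_euler_step_diff_le IH h L by (metis less_imp_le)
        moreover have "W (Suc ?n) = W ?n + h *\<^sub>R \<Phi> ?s (W ?n)"
          by (rule euler_step_eq[OF h(1) W[OF _ n]]) simp
        moreover have "norm (z (?s + h) - (z ?s + h *\<^sub>R \<Phi> ?s (z ?s))) \<le> \<tau> * h\<^sup>2"
          using truncation grid[OF h(1) n] h by blast
        ultimately have "norm (W (Suc ?n) - z (?s + h)) \<le> (?e + h * L * ?e) + \<tau> * h\<^sup>2"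
          using norm_triangle_ineq4[of "W (Suc ?n) - (z ?s + h *\<^sub>R \<Phi> ?s (z ?s))"
              "z (?s + h) - (z ?s + h *\<^sub>R \<Phi> ?s (z ?s))"] by simp
        also have "\<dots> \<le> \<tau> * h * (real k * h) * (1 + h * L) ^ Suc k + \<tau> * h\<^sup>2 * (1 + h * L) ^ Suc k"
        proof (rule add_mono)
          show "?e + h * L * ?e \<le> \<tau> * h * (real k * h) * (1 + h * L) ^ Suc k"
            by (simp add: algebra_simps)
          have "1 \<le> (1 + h * L) ^ Suc k"
            using L h by (intro one_le_power) simp
          then show "\<tau> * h\<^sup>2 \<le> \<tau> * h\<^sup>2 * (1 + h * L) ^ Suc k"
            using mult_left_mono[of 1 "(1 + h * L) ^ Suc k" "\<tau> * h\<^sup>2"] \<tau> by simp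
        qed
        also have "\<dots> = \<tau> * h * (real (Suc k) * h) * (1 + h * L) ^ Suc k"
          by (simp add: power2_eq_square algebra_simps)
        finally show ?case
          using grid(3)[OF h(1) n] by (simp only: add_Suc_right)
      qed (use W0 in simp)
      assume n: "n \<in> {m..num_steps T h}"
      then have "norm (W n - z (real n * h)) \<le> \<tau> * h * (real (n - m) * h) * (1 + h * L) ^ (n - m)"
        using err[of "n - m"] by simp
      also have "\<dots> \<le> C * h"
        using n by (intro le_C) auto
      finally show "norm (W n - z (real n * h)) \<le> C * h" .
    qed
  qed
qed

text \<open>The schemes are compared at equal times, so only the slow and fast parts of the product
  distance remain.\<close>

lemma bdd_lipschitz_productE:
  fixes G :: "real \<Rightarrow> 'a::real_normed_vector \<Rightarrow> 'b::real_normed_vector \<Rightarrow> 'c::real_normed_vector"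
  assumes "bdd_lipschitz ({0..} \<times> A \<times> cball 0 B) (\<lambda>(t, Z, u). G t Z u)"
  obtains K where "0 < K"
    "\<And>t Z u. 0 \<le> t \<Longrightarrow> Z \<in> A \<Longrightarrow> norm u \<le> B \<Longrightarrow> norm (G t Z u) \<le> K"
    "\<And>t Z Z' u u'. 0 \<le> t \<Longrightarrow> Z \<in> A \<Longrightarrow> Z' \<in> A \<Longrightarrow> norm u \<le> B \<Longrightarrow> norm u' \<le> B \<Longrightarrow>
      norm (G t Z u - G t Z' u') \<le> K * (norm (Z - Z') + norm (u - u'))"
proof -
  let ?S = "{0..} \<times> A \<times> cball (0::'b) B"
  obtain K where K: "0 < K" "\<And>p. p \<in> ?S \<Longrightarrow> norm ((\<lambda>(t, Z, u). G t Z u) p) \<le> K"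
    "\<And>p q. p \<in> ?S \<Longrightarrow> q \<in> ?S \<Longrightarrow>
      norm ((\<lambda>(t, Z, u). G t Z u) p - (\<lambda>(t, Z, u). G t Z u) q) \<le> K * dist p q"
    using bdd_lipschitzE[OF assms] by metis
  show thesis
  proof (rule that[OF K(1)])
    show "norm (G t Z u) \<le> K" if "0 \<le> t" "Z \<in> A" "norm u \<le> B" for t Z u
      using K(2)[of "(t, Z, u)"] that by simp
    show "norm (G t Z u - G t Z' u') \<le> K * (norm (Z - Z') + norm (u - u'))"
      if "0 \<le> t" "Z \<in> A" "Z' \<in> A" "norm u \<le> B" "norm u' \<le> B" for t Z Z' u u'
    proof -
      have "norm (G t Z u - G t Z' u') \<le> K * dist (t, Z, u) (t, Z', u')"
        using K(3)[of "(t, Z, u)" "(t, Z', u')"] that by simp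
      also have "\<dots> \<le> K * (norm (Z - Z') + norm (u - u'))"
        using K(1) norm_Pair_le[of "Z - Z'" "u - u'"]
        by (intro mult_left_mono) (auto simp: dist_norm norm_Pair)
      finally show ?thesis .
    qed
  qed
qed

text \<open>The two ways of keeping radii admissible: closeness within the margin \<delta>, or
  confinement by hypothesis. In both cases \<open>v\<close> and \<open>w\<close> may move by
  \<open>C'\<close>, since only the radius has a boundary to avoid.\<close>

lemma near_tube:
  assumes "W \<in> tube \<rho>1 \<rho>2 C" "norm (Z - W) \<le> d" "d \<le> C'" "d \<le> \<delta> \<or> radius Z \<in> {\<rho>1..\<rho>2}" "0 \<le> \<delta>"
  shows "Z \<in> tube (\<rho>1 - \<delta>) (\<rho>2 + \<delta>) (C + C')"
  using tube_enlarge[OF assms(1,2)] assms(3-5) unfolding tube_def by auto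

text \<open>Linearity in \<epsilon> lets the bounds be fixed once at \<epsilon> = 1 and hence be
  uniform in \<epsilon>.\<close>

lemma slaved_velocity_scale: "slaved_velocity D \<epsilon> t Z = \<epsilon> *\<^sub>R slaved_velocity D 1 t Z"
  by (simp add: slaved_velocity_def)

context toroidal_fields
begin

lemma compact_subset_tube:
  assumes "compact K" "K \<subseteq> slow_domain D"
  obtains \<rho>1 \<rho>2 B where "0 < \<rho>1" "\<rho>2 < R0 D" "K \<subseteq> tube \<rho>1 \<rho>2 B"
proof (cases "K = {}")
  case True
  \<comment> \<open>Default radii for the empty set, admissible whatever the value of
    \<open>R0 D\<close>.\<close>
  then show thesis
    using that[of 1 "R0 D - 1"] by simp
next
  case False
  have rad: "radius = fst"
    by (rule ext) (metis prod.exhaust radius.simps fst_conv)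
  have cont: "continuous_on K radius"
    unfolding rad by (intro continuous_intros)
  obtain Z1 where Z1: "Z1 \<in> K" "\<forall>Z\<in>K. radius Z1 \<le> radius Z"
    using continuous_attains_inf[OF assms(1) False cont] by blast
  obtain Z2 where Z2: "Z2 \<in> K" "\<forall>Z\<in>K. radius Z \<le> radius Z2"
    using continuous_attains_sup[OF assms(1) False cont] by blast
  obtain B where B: "\<And>Z. Z \<in> K \<Longrightarrow> norm Z \<le> B"
    using compact_imp_bounded[OF assms(1)] by (auto simp: bounded_iff)
  show thesis
  proof (rule that)
    show "0 < radius Z1" "radius Z2 < R0 D"
      using Z1 Z2 assms(2) by (auto simp: slow_domain_def)
    show "K \<subseteq> tube (radius Z1) (radius Z2) B"
    proof
      fix Z assume Z: "Z \<in> K"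
      show "Z \<in> tube (radius Z1) (radius Z2) B"
        using Z1(2) Z2(2) Z order_trans[OF slow_component_bounds(2) B[OF Z]]
          order_trans[OF slow_component_bounds(3) B[OF Z]] by (simp add: tube_def)
    qed
  qed
qed

lemma open_slow_domain: "open (slow_domain D)"
proof -
  have "slow_domain D = {0<..<R0 D} \<times> UNIV"
    by (auto simp: slow_domain_def)
  then show ?thesis
    by (simp add: open_Times)
qed

lemma consistent_first_order_fields:
  assumes "0 < T"
  shows "consistent_first_order T (slow_domain D) (gyrokinetic_field D) (gyrokinetic_field D)"
    and "consistent_first_order T (slow_domain D) (corrected_field D \<epsilon>) (corrected_field D \<epsilon>)"
proof -
  have *: "consistent_first_order T (slow_domain D) \<Phi> \<Phi>"
    if "\<And>\<rho>1 \<rho>2 B. 0 < \<rho>1 \<Longrightarrow> \<rho>2 < R0 D \<Longrightarrow>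
      bdd_lipschitz ({0..} \<times> tube \<rho>1 \<rho>2 B) (\<lambda>(t, Z). \<Phi> t Z)" for \<Phi>
  proof (rule lipschitz_imp_consistent_first_order[OF open_slow_domain assms])
    fix K assume "compact K" "K \<subseteq> slow_domain D"
    then obtain \<rho>1 \<rho>2 B where "0 < \<rho>1" "\<rho>2 < R0 D" "K \<subseteq> tube \<rho>1 \<rho>2 B"
      using compact_subset_tube by blast
    then show "bdd_lipschitz ({0..} \<times> K) (\<lambda>(t, z). \<Phi> t z)"
      by (intro bdd_lipschitz_subset[OF that]) auto
  qed
  show "consistent_first_order T (slow_domain D) (gyrokinetic_field D) (gyrokinetic_field D)"
    by (rule *) (rule gyrokinetic_field_bdd_lipschitz)
  show "consistent_first_order T (slow_domain D) (corrected_field D \<epsilon>) (corrected_field D \<epsilon>)"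
    by (rule *) (rule corrected_field_bdd_lipschitz)
qed

lemma radius_margin:
  assumes "0 < \<rho>1" "\<rho>2 < R0 D"
  obtains \<delta> where "0 < \<delta>" "0 < \<rho>1 - \<delta>" "\<rho>2 + \<delta> < R0 D"
proof (rule that[of "min (\<rho>1 / 2) ((R0 D - \<rho>2) / 2)"])
  show "\<rho>2 + min (\<rho>1 / 2) ((R0 D - \<rho>2) / 2) < R0 D"
    using assms min.cobounded2[of "\<rho>1 / 2" "(R0 D - \<rho>2) / 2"] by (simp add: min_def field_simps)
qed (use assms in \<open>auto simp: min_def\<close>)

end

section \<open>Error estimates for well-prepared data\<close>

context toroidal_fields
begin

text \<open>Only boundedness of the old \<open>u\<close> is assumed, as the initial datum offers no
  more, yet the new one is O(\<epsilon>). The constants depend on the step size, the radius range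
  and \<open>C\<close> alone.\<close>

lemma first_order_step:
  assumes "0 < h" "0 < \<rho>1" "\<rho>2 < R0 D" "0 < C"
  obtains C' e where "C \<le> C'" "0 < e"
    "\<And>t \<epsilon> Z u Z' u' W W'. \<lbrakk>0 \<le> t; 0 < \<epsilon>; \<epsilon> \<le> 1; (Z' - Z) /\<^sub>R h = F D t Z u';
      J0 ((u' - u) /\<^sub>R h) = U_perp D t Z u - (b_at D Z / \<epsilon>) *\<^sub>R u';
      (W' - W) /\<^sub>R h = gyrokinetic_field D t W;
      W \<in> tube \<rho>1 \<rho>2 C; norm (Z - W) \<le> C * \<epsilon>; norm u \<le> C;
      \<epsilon> \<le> e \<or> radius Z \<in> {\<rho>1..\<rho>2}\<rbrakk>
      \<Longrightarrow> W' \<in> tube \<rho>1 \<rho>2 C' \<and> norm (Z' - W') \<le> C' * \<epsilon> \<and> norm u' \<le> C' * \<epsilon>"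
proof -
  obtain \<delta> where \<delta>: "0 < \<delta>" "0 < \<rho>1 - \<delta>" "\<rho>2 + \<delta> < R0 D"
    using radius_margin[OF assms(2,3)] .
  \<comment> \<open>\<open>Z\<close> lies within C\<epsilon>, hence within \<open>C\<close>, of a
    point of the tube of size \<open>C\<close>.\<close>
  let ?S = "tube (\<rho>1 - \<delta>) (\<rho>2 + \<delta>) (C + C)"
  obtain c where c: "0 < c" "\<And>Z B. Z \<in> tube (\<rho>1 - \<delta>) (\<rho>2 + \<delta>) B \<Longrightarrow> c \<le> b_at D Z"
    using b_at_bounded_below[OF \<delta>(2,3)] by metis
  obtain KU where KU: "0 < KU"
    "\<And>t Z u. 0 \<le> t \<Longrightarrow> Z \<in> ?S \<Longrightarrow> norm u \<le> C \<Longrightarrow> norm (U_perp D t Z u) \<le> KU"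
    using bdd_lipschitz_productE[OF U_perp_bdd_lipschitz[OF \<delta>(2,3)]] by metis
  \<comment> \<open>The bound of \<open>implicit_step_norm_le\<close> with c/\<epsilon> as the
    coefficient, after division by \<epsilon>.\<close>
  define A where "A = (C / h + KU) / c"
  have A: "0 < A"
    using assms c KU by (simp add: A_def add_pos_pos)
  obtain KF where KF: "0 < KF"
    "\<And>t Z u. 0 \<le> t \<Longrightarrow> Z \<in> ?S \<Longrightarrow> norm u \<le> A \<Longrightarrow> norm (F D t Z u) \<le> KF"
    "\<And>t Z Z' u u'. 0 \<le> t \<Longrightarrow> Z \<in> ?S \<Longrightarrow> Z' \<in> ?S \<Longrightarrow> norm u \<le> A \<Longrightarrow> norm u' \<le> A \<Longrightarrow>
      norm (F D t Z u - F D t Z' u') \<le> KF * (norm (Z - Z') + norm (u - u'))"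
    using bdd_lipschitz_productE[OF F_bdd_lipschitz[OF \<delta>(2,3)]] by metis
  \<comment> \<open>In turn: the propagated slow error, the growth of \<open>v\<close> and
    \<open>w\<close> in the limiting sequence, and the new fast variable.\<close>
  define C' where "C' = C + h * KF * (C + A) + h * KF + A"
  show thesis
  proof (rule that)
    show "C \<le> C'" "0 < \<delta> / C"
      using assms \<delta> A KF by (auto simp: C'_def)
    fix t \<epsilon> Z u Z' u' W W'
    assume t: "0 \<le> t" and \<epsilon>: "0 < \<epsilon>" "\<epsilon> \<le> 1"
      and Z': "(Z' - Z) /\<^sub>R h = F D t Z u'"
      and u': "J0 ((u' - u) /\<^sub>R h) = U_perp D t Z u - (b_at D Z / \<epsilon>) *\<^sub>R u'"
      and W': "(W' - W) /\<^sub>R h = gyrokinetic_field D t W"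
      and W: "W \<in> tube \<rho>1 \<rho>2 C" and ZW: "norm (Z - W) \<le> C * \<epsilon>" and u: "norm u \<le> C"
      and small: "\<epsilon> \<le> \<delta> / C \<or> radius Z \<in> {\<rho>1..\<rho>2}"
    have C\<epsilon>: "C * \<epsilon> \<le> C"
      using assms(4) \<epsilon> by (simp add: mult_left_le)
    have ZS: "Z \<in> ?S"
      using small assms(4) \<delta> C\<epsilon> by (intro near_tube[OF W ZW]) (auto simp: field_simps)
    have WS: "W \<in> ?S"
      using W \<delta> assms(4) tube_mono[of "\<rho>1 - \<delta>" \<rho>1 \<rho>2 "\<rho>2 + \<delta>" C "C + C"] by auto
    have b: "c \<le> b_at D Z" "0 < b_at D Z"
      using c(2)[OF ZS] c(1) by auto
    have "norm u' \<le> (norm u / h + norm (U_perp D t Z u)) / (b_at D Z / \<epsilon>)"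
      using b \<epsilon> assms(1) by (intro implicit_step_norm_le[OF u']) auto
    also have "\<dots> \<le> (C / h + KU) / (c / \<epsilon>)"
      using b \<epsilon> assms(1) c(1) u KU(1) KU(2)[OF t ZS u] order_trans[OF norm_ge_zero u]
      by (intro frac_le add_mono divide_right_mono) auto
    finally have u'A: "norm u' \<le> A * \<epsilon>"
      by (simp add: A_def)
    then have u'A': "norm u' \<le> A"
      using mult_left_le[of \<epsilon> A] \<epsilon> A by linarith
    note Z'' = euler_step_eq[OF assms(1) Z'] and W'' = euler_step_eq[OF assms(1) W']
    have FW: "norm (gyrokinetic_field D t W) \<le> KF"
      using KF(2)[OF t WS, of 0] A by (simp add: gyrokinetic_field_def)
    have "norm (F D t Z u' - gyrokinetic_field D t W) \<le> KF * (norm (Z - W) + norm u')"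
      using KF(3)[OF t ZS WS u'A', of 0] A by (simp add: gyrokinetic_field_def)
    also have "\<dots> \<le> KF * (C * \<epsilon> + A * \<epsilon>)"
      using ZW u'A KF(1) by (intro mult_left_mono add_mono) auto
    finally have "norm (F D t Z u' - gyrokinetic_field D t W) \<le> KF * (C * \<epsilon> + A * \<epsilon>)" .
    then have "norm (Z' - W') \<le> C * \<epsilon> + h * KF * (C * \<epsilon> + A * \<epsilon>)"
      unfolding Z'' W'' using assms(1) KF(1) ZW by (intro norm_euler_step_diff_le) auto
    also have "\<dots> = (C + h * KF * (C + A)) * \<epsilon>"
      by (simp add: algebra_simps)
    also have "\<dots> \<le> C' * \<epsilon>"
      using \<epsilon> A KF(1) assms(1) by (intro mult_right_mono) (auto simp: C'_def)
    finally have ZW': "norm (Z' - W') \<le> C' * \<epsilon>" .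
    have "A * \<epsilon> \<le> C' * \<epsilon>"
      using \<epsilon> A KF(1) assms by (intro mult_right_mono) (auto simp: C'_def)
    then have u'C: "norm u' \<le> C' * \<epsilon>"
      using u'A by linarith
    have "norm (W' - W) \<le> h * KF"
      unfolding W'' using FW assms(1) by (simp add: mult_left_mono)
    then have "W' \<in> tube (\<rho>1 - h * KF) (\<rho>2 + h * KF) (C + h * KF)"
      by (rule tube_enlarge[OF W])
    \<comment> \<open>Conservation of the radius undoes the radial widening just obtained; only the
      bound on \<open>v\<close> and \<open>w\<close> grows.\<close>
    moreover have "radius W' = radius W"
      unfolding W'' by (simp add: radius_add_scaleR gyrokinetic_field_radius)
    moreover have "C + h * KF \<le> C'"
      using A KF(1) assms by (simp add: C'_def)
    ultimately have "W' \<in> tube \<rho>1 \<rho>2 C'"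
      using W by (auto simp: tube_def)
    then show "W' \<in> tube \<rho>1 \<rho>2 C' \<and> norm (Z' - W') \<le> C' * \<epsilon> \<and> norm u' \<le> C' * \<epsilon>"
      using ZW' u'C by blast
  qed
qed

text \<open>Here both the old and the new fast variable are O(\<epsilon>), so their difference is
  too and \<open>implicit_step_expansion\<close> is accurate to second order. \<open>W\<close>
  merely anchors \<open>Z\<close> and \<open>Y\<close> in a common tube.\<close>

lemma second_order_step:
  assumes "0 < h" "0 < \<rho>1" "\<rho>2 < R0 D" "0 < C"
  obtains C' e where "C \<le> C'" "0 < e"
    "\<And>t \<epsilon> Z u Z' u' W Y Y'. \<lbrakk>0 \<le> t; 0 < \<epsilon>; \<epsilon> \<le> 1; (Z' - Z) /\<^sub>R h = F D t Z u';
      J0 ((u' - u) /\<^sub>R h) = U_perp D t Z u - (b_at D Z / \<epsilon>) *\<^sub>R u';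
      (Y' - Y) /\<^sub>R h = corrected_field D \<epsilon> t Y;
      W \<in> tube \<rho>1 \<rho>2 C; norm (Z - W) \<le> C * \<epsilon>; norm (Z - Y) \<le> C * \<epsilon>\<^sup>2;
      norm u \<le> C * \<epsilon>; norm u' \<le> C * \<epsilon>;
      \<epsilon> \<le> e \<or> radius Z \<in> {\<rho>1..\<rho>2} \<and> radius Y \<in> {\<rho>1..\<rho>2}\<rbrakk>
      \<Longrightarrow> norm (Z' - Y') \<le> C' * \<epsilon>\<^sup>2 \<and> norm (u' - slaved_velocity D \<epsilon> t Y) \<le> C' * \<epsilon>\<^sup>2"
proof -
  obtain \<delta> where \<delta>: "0 < \<delta>" "0 < \<rho>1 - \<delta>" "\<rho>2 + \<delta> < R0 D"
    using radius_margin[OF assms(2,3)] .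
  \<comment> \<open>\<open>Y\<close> is within C\<epsilon> of \<open>Z\<close> and \<open>Z\<close>
    within C\<epsilon> of \<open>W\<close>, hence the \<open>2 * C\<close>.\<close>
  let ?S = "tube (\<rho>1 - \<delta>) (\<rho>2 + \<delta>) (C + 2 * C)"
  obtain c where c: "0 < c" "\<And>Z B. Z \<in> tube (\<rho>1 - \<delta>) (\<rho>2 + \<delta>) B \<Longrightarrow> c \<le> b_at D Z"
    using b_at_bounded_below[OF \<delta>(2,3)] by metis
  obtain KU where KU: "0 < KU"
    "\<And>t Z Z' u u'. 0 \<le> t \<Longrightarrow> Z \<in> ?S \<Longrightarrow> Z' \<in> ?S \<Longrightarrow> norm u \<le> C \<Longrightarrow> norm u' \<le> C \<Longrightarrow>
      norm (U_perp D t Z u - U_perp D t Z' u') \<le> KU * (norm (Z - Z') + norm (u - u'))"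
    using bdd_lipschitz_productE[OF U_perp_bdd_lipschitz[OF \<delta>(2,3)]] by metis
  let ?s = "\<lambda>(t, Z). slaved_velocity D 1 t Z"
  obtain KS where KS: "0 < KS" "\<And>p. p \<in> {0..} \<times> ?S \<Longrightarrow> norm (?s p) \<le> KS"
    "\<And>p q. p \<in> {0..} \<times> ?S \<Longrightarrow> q \<in> {0..} \<times> ?S \<Longrightarrow> norm (?s p - ?s q) \<le> KS * dist p q"
    using bdd_lipschitzE[OF slaved_velocity_bdd_lipschitz[OF \<delta>(2,3)]] by metis
  \<comment> \<open>A radius containing both fast arguments fed to \<open>F\<close>:
    \<open>u'\<close>, bounded by \<open>C\<close>, and the slaved velocity, bounded by
    \<open>KS\<close>.\<close>
  define A where "A = C + KS"
  obtain KF where KF: "0 < KF"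
    "\<And>t Z Z' u u'. 0 \<le> t \<Longrightarrow> Z \<in> ?S \<Longrightarrow> Z' \<in> ?S \<Longrightarrow> norm u \<le> A \<Longrightarrow> norm u' \<le> A \<Longrightarrow>
      norm (F D t Z u - F D t Z' u') \<le> KF * (norm (Z - Z') + norm (u - u'))"
    using bdd_lipschitz_productE[OF F_bdd_lipschitz[OF \<delta>(2,3)]] by metis
  \<comment> \<open>The three summands match the errors \<open>d1\<close>, \<open>d2\<close>,
    \<open>d3\<close> below: the time difference of \<open>u\<close>, replacing \<open>u\<close> by
    0 in \<open>U_perp\<close>, and replacing \<open>Z\<close> by \<open>Y\<close> in the slaved
    velocity.\<close>
  define B where "B = 2 * C / (h * c) + KU * C / c + KS * C"
  have B: "0 < B"
    using assms c KU KS by (auto simp: B_def intro!: add_pos_pos)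
  define C' where "C' = C + h * KF * (C + B) + B"
  show thesis
  proof (rule that)
    show "C \<le> C'" "0 < \<delta> / (2 * C)"
      using assms \<delta> B KF by (auto simp: C'_def)
    fix t \<epsilon> Z u Z' u' W Y Y'
    assume t: "0 \<le> t" and \<epsilon>: "0 < \<epsilon>" "\<epsilon> \<le> 1"
      and Z': "(Z' - Z) /\<^sub>R h = F D t Z u'"
      and u': "J0 ((u' - u) /\<^sub>R h) = U_perp D t Z u - (b_at D Z / \<epsilon>) *\<^sub>R u'"
      and Y': "(Y' - Y) /\<^sub>R h = corrected_field D \<epsilon> t Y"
      and W: "W \<in> tube \<rho>1 \<rho>2 C" and ZW: "norm (Z - W) \<le> C * \<epsilon>"
      and ZY: "norm (Z - Y) \<le> C * \<epsilon>\<^sup>2"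
      and uC: "norm u \<le> C * \<epsilon>" and u'C: "norm u' \<le> C * \<epsilon>"
      and small: "\<epsilon> \<le> \<delta> / (2 * C) \<or> radius Z \<in> {\<rho>1..\<rho>2} \<and> radius Y \<in> {\<rho>1..\<rho>2}"
    have C\<epsilon>: "C * \<epsilon> \<le> C" "C * \<epsilon>\<^sup>2 \<le> C * \<epsilon>"
      using assms(4) \<epsilon> by (simp_all add: mult_left_le power2_eq_square)
    have u_le: "norm u \<le> C" "norm u' \<le> C"
      using uC u'C C\<epsilon> by auto
    have ZW2: "norm (Z - W) \<le> 2 * C * \<epsilon>"
      using ZW norm_ge_zero[of "Z - W"] by linarith
    have YW: "norm (Y - W) \<le> 2 * C * \<epsilon>"
      using norm_triangle_ineq4[of "Z - W" "Z - Y"] ZW ZY C\<epsilon>(2) by (simp add: algebra_simps)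
    have ZS: "Z \<in> ?S" and YS: "Y \<in> ?S"
      using small assms(4) \<delta> C\<epsilon> by (intro near_tube[OF W ZW2] near_tube[OF W YW]; auto simp: field_simps)+
    have b: "c \<le> b_at D Z" "0 < b_at D Z"
      using c(2)[OF ZS] c(1) by auto
    have "norm (u' - U_perp D t Z u /\<^sub>R (b_at D Z / \<epsilon>)) = norm (u' - u) / (h * (b_at D Z / \<epsilon>))"
      using b \<epsilon> assms(1) by (intro implicit_step_expansion[OF u']) auto
    also have "\<dots> \<le> (2 * C * \<epsilon>) / (h * (c / \<epsilon>))"
      using b \<epsilon> assms c(1) uC u'C norm_triangle_ineq4[of u' u]
      by (intro frac_le mult_left_mono divide_right_mono) auto
    also have "\<dots> = 2 * C / (h * c) * \<epsilon>\<^sup>2"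
      by (simp add: power2_eq_square)
    finally have d1: "norm (u' - U_perp D t Z u /\<^sub>R (b_at D Z / \<epsilon>)) \<le> 2 * C / (h * c) * \<epsilon>\<^sup>2" .
    have "U_perp D t Z u /\<^sub>R (b_at D Z / \<epsilon>) - slaved_velocity D \<epsilon> t Z
        = (\<epsilon> / b_at D Z) *\<^sub>R (U_perp D t Z u - U_perp D t Z 0)"
      by (simp add: slaved_velocity_def Ubar_def scaleR_diff_right)
    also have "norm \<dots> = \<epsilon> / b_at D Z * norm (U_perp D t Z u - U_perp D t Z 0)"
      using \<epsilon> b by simp
    also have "\<dots> \<le> \<epsilon> / c * (KU * (C * \<epsilon>))"
    proof (rule mult_mono)
      show "norm (U_perp D t Z u - U_perp D t Z 0) \<le> KU * (C * \<epsilon>)"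
        by (rule order_trans[OF KU(2)[OF t ZS ZS u_le(1), of 0]]) (use uC KU(1) assms(4) in simp_all)
    qed (use b c \<epsilon> in \<open>auto intro: divide_left_mono\<close>)
    also have "\<dots> = KU * C / c * \<epsilon>\<^sup>2"
      by (simp add: power2_eq_square)
    finally have d2: "norm (U_perp D t Z u /\<^sub>R (b_at D Z / \<epsilon>) - slaved_velocity D \<epsilon> t Z)
      \<le> KU * C / c * \<epsilon>\<^sup>2" .
    have "norm (slaved_velocity D \<epsilon> t Z - slaved_velocity D \<epsilon> t Y)
        = \<epsilon> * norm (slaved_velocity D 1 t Z - slaved_velocity D 1 t Y)"
    proof -
      have "slaved_velocity D \<epsilon> t Z - slaved_velocity D \<epsilon> t Y
          = \<epsilon> *\<^sub>R (slaved_velocity D 1 t Z - slaved_velocity D 1 t Y)"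
        unfolding slaved_velocity_scale[of D \<epsilon>] scaleR_diff_right ..
      then show ?thesis
        using \<epsilon>(1) by simp
    qed
    also have "\<dots> \<le> 1 * (KS * (C * \<epsilon>\<^sup>2))"
    proof (rule mult_mono)
      show "norm (slaved_velocity D 1 t Z - slaved_velocity D 1 t Y) \<le> KS * (C * \<epsilon>\<^sup>2)"
      proof (rule order_trans)
        show "norm (slaved_velocity D 1 t Z - slaved_velocity D 1 t Y) \<le> KS * norm (Z - Y)"
          using KS(3)[of "(t, Z)" "(t, Y)"] t ZS YS by (simp add: dist_Pair_Pair dist_norm)
      qed (use ZY KS(1) in simp)
    qed (use \<epsilon> in auto)
    finally have d3: "norm (slaved_velocity D \<epsilon> t Z - slaved_velocity D \<epsilon> t Y) \<le> KS * C * \<epsilon>\<^sup>2"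
      by simp
    have "norm (u' - slaved_velocity D \<epsilon> t Y) \<le> 2 * C / (h * c) * \<epsilon>\<^sup>2 + KU * C / c * \<epsilon>\<^sup>2 + KS * C * \<epsilon>\<^sup>2"
      using norm_triangle_ineq[of "u' - U_perp D t Z u /\<^sub>R (b_at D Z / \<epsilon>)"
          "U_perp D t Z u /\<^sub>R (b_at D Z / \<epsilon>) - slaved_velocity D \<epsilon> t Z"]
        norm_triangle_ineq[of "u' - slaved_velocity D \<epsilon> t Z"
          "slaved_velocity D \<epsilon> t Z - slaved_velocity D \<epsilon> t Y"] d1 d2 d3 by simp
    then have dB: "norm (u' - slaved_velocity D \<epsilon> t Y) \<le> B * \<epsilon>\<^sup>2"
      by (simp add: B_def algebra_simps)
    have sA: "norm (slaved_velocity D \<epsilon> t Y) \<le> A"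
    proof -
      have "norm (slaved_velocity D \<epsilon> t Y) = \<epsilon> * norm (slaved_velocity D 1 t Y)"
        unfolding slaved_velocity_scale[of D \<epsilon>] using \<epsilon>(1) by simp
      also have "\<dots> \<le> 1 * KS"
        using KS(2)[of "(t, Y)"] t YS \<epsilon> by (intro mult_mono) auto
      finally show ?thesis
        using assms(4) by (simp add: A_def)
    qed
    have "norm (F D t Z u' - corrected_field D \<epsilon> t Y)
        \<le> KF * (norm (Z - Y) + norm (u' - slaved_velocity D \<epsilon> t Y))"
      unfolding corrected_field_def using u_le KS(1) by (intro KF(2) t ZS YS sA) (simp add: A_def)
    also have "\<dots> \<le> KF * (C * \<epsilon>\<^sup>2 + B * \<epsilon>\<^sup>2)"
      using ZY dB KF(1) by (intro mult_left_mono add_mono) auto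
    finally have "norm (F D t Z u' - corrected_field D \<epsilon> t Y) \<le> KF * (C * \<epsilon>\<^sup>2 + B * \<epsilon>\<^sup>2)" .
    then have "norm (Z' - Y') \<le> C * \<epsilon>\<^sup>2 + h * KF * (C * \<epsilon>\<^sup>2 + B * \<epsilon>\<^sup>2)"
      unfolding euler_step_eq[OF assms(1) Z'] euler_step_eq[OF assms(1) Y']
      using assms(1) KF(1) ZY by (intro norm_euler_step_diff_le) auto
    also have "\<dots> = (C + h * KF * (C + B)) * \<epsilon>\<^sup>2"
      by (simp add: algebra_simps)
    also have "\<dots> \<le> C' * \<epsilon>\<^sup>2"
      using B by (intro mult_right_mono) (auto simp: C'_def)
    finally have "norm (Z' - Y') \<le> C' * \<epsilon>\<^sup>2" .
    moreover have "B * \<epsilon>\<^sup>2 \<le> C' * \<epsilon>\<^sup>2"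
      using B KF(1) assms by (intro mult_right_mono) (auto simp: C'_def)
    ultimately show "norm (Z' - Y') \<le> C' * \<epsilon>\<^sup>2 \<and> norm (u' - slaved_velocity D \<epsilon> t Y) \<le> C' * \<epsilon>\<^sup>2"
      using dB by linarith
  qed
qed

end

section \<open>Induction over the time steps with constants uniform over all runs\<close>

lemma semi_implicit_schemeD:
  assumes "semi_implicit_scheme D h N \<epsilon> Z u" "n < N"
  shows "(Z (Suc n) - Z n) /\<^sub>R h = F D (real n * h) (Z n) (u (Suc n))"
    and "J0 ((u (Suc n) - u n) /\<^sub>R h) =
       U_perp D (real n * h) (Z n) (u n) - (b_at D (Z n) / \<epsilon>) *\<^sub>R u (Suc n)"
  using assms unfolding semi_implicit_scheme_def by auto

lemma one_step_schemeD:
  "one_step_scheme h m N \<Phi> W \<Longrightarrow> m \<le> n \<Longrightarrow> n < N \<Longrightarrow> (W (Suc n) - W n) /\<^sub>R h = \<Phi> (real n * h) (W n)"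
  unfolding one_step_scheme_def by auto

text \<open>Describes a run at one single \<epsilon>; quantifying over such runs makes the constants
  uniform in \<epsilon> and in the data. The same \<open>M\<close> bounds the initial errors and the
  \<open>v\<close>, \<open>w\<close> of the limiting datum.\<close>

definition well_prepared_run ::
  "toroidal_data \<Rightarrow> real \<Rightarrow> nat \<Rightarrow> real \<Rightarrow> real \<Rightarrow> real \<Rightarrow> real \<Rightarrow> (nat \<Rightarrow> slow) \<Rightarrow> (nat \<Rightarrow> fast) \<Rightarrow>
    (nat \<Rightarrow> slow) \<Rightarrow> bool" where
  "well_prepared_run D h N \<rho>1 \<rho>2 M \<epsilon> Z u W \<longleftrightarrow>
     0 < \<epsilon> \<and> \<epsilon> \<le> 1 \<and> semi_implicit_scheme D h N \<epsilon> Z u \<and>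
     one_step_scheme h 0 N (gyrokinetic_field D) W \<and>
     W 0 \<in> tube \<rho>1 \<rho>2 M \<and> norm (Z 0 - W 0) \<le> M * \<epsilon> \<and> norm (u 0) \<le> M"

context toroidal_fields
begin

text \<open>Each induction step replaces the constant by a larger one and the threshold by a smaller
  one. The fast bound splits by index, since at index 0 it is only O(1).\<close>

lemma first_order_error:
  assumes "0 < h" "0 < \<rho>1" "\<rho>2 < R0 D" "0 < M"
  shows "\<exists>C e. 0 < C \<and> 0 < e \<and> (\<forall>\<epsilon> Z u W. well_prepared_run D h N \<rho>1 \<rho>2 M \<epsilon> Z u W \<and>
      (\<epsilon> \<le> e \<or> (\<forall>k<N. radius (Z k) \<in> {\<rho>1..\<rho>2})) \<longrightarrow>
      (\<forall>k\<le>n. k \<le> N \<longrightarrow> W k \<in> tube \<rho>1 \<rho>2 C \<and> norm (Z k - W k) \<le> C * \<epsilon> \<and> norm (u k) \<le> C \<and>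
        (1 \<le> k \<longrightarrow> norm (u k) \<le> C * \<epsilon>)))"
proof (induction n)
  case 0
  show ?case
    by (rule exI[of _ M], rule exI[of _ 1]) (auto simp: assms well_prepared_run_def)
next
  case (Suc n)
  from Suc.IH obtain C e where C: "0 < C" "0 < e" and IH: "\<forall>\<epsilon> Z u W. well_prepared_run D h N \<rho>1 \<rho>2 M \<epsilon> Z u W \<and>
      (\<epsilon> \<le> e \<or> (\<forall>k<N. radius (Z k) \<in> {\<rho>1..\<rho>2})) \<longrightarrow>
      (\<forall>k\<le>n. k \<le> N \<longrightarrow> W k \<in> tube \<rho>1 \<rho>2 C \<and> norm (Z k - W k) \<le> C * \<epsilon> \<and> norm (u k) \<le> C \<and>
        (1 \<le> k \<longrightarrow> norm (u k) \<le> C * \<epsilon>))"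
    by (elim exE conjE) (rule that)
  obtain C' e' where C': "C \<le> C'" "0 < e'" and step:
    "\<And>t \<epsilon> Z u Z' u' W W'. \<lbrakk>0 \<le> t; 0 < \<epsilon>; \<epsilon> \<le> 1; (Z' - Z) /\<^sub>R h = F D t Z u';
      J0 ((u' - u) /\<^sub>R h) = U_perp D t Z u - (b_at D Z / \<epsilon>) *\<^sub>R u';
      (W' - W) /\<^sub>R h = gyrokinetic_field D t W;
      W \<in> tube \<rho>1 \<rho>2 C; norm (Z - W) \<le> C * \<epsilon>; norm u \<le> C;
      \<epsilon> \<le> e' \<or> radius Z \<in> {\<rho>1..\<rho>2}\<rbrakk>
      \<Longrightarrow> W' \<in> tube \<rho>1 \<rho>2 C' \<and> norm (Z' - W') \<le> C' * \<epsilon> \<and> norm u' \<le> C' * \<epsilon>"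
    using first_order_step[OF assms(1-3) C(1)] by metis
  show ?case
  proof (rule exI[of _ C'], rule exI[of _ "min e e'"], intro conjI allI impI)
    show "0 < C'" "0 < min e e'"
      using C C' by auto
  next
    fix \<epsilon> Z u W k
    assume run: "well_prepared_run D h N \<rho>1 \<rho>2 M \<epsilon> Z u W \<and>
      (\<epsilon> \<le> min e e' \<or> (\<forall>k<N. radius (Z k) \<in> {\<rho>1..\<rho>2}))" and k: "k \<le> Suc n" "k \<le> N"
    then have \<epsilon>: "0 < \<epsilon>" "\<epsilon> \<le> 1" and sch: "semi_implicit_scheme D h N \<epsilon> Z u"
      and one: "one_step_scheme h 0 N (gyrokinetic_field D) W"
      by (auto simp: well_prepared_run_def)
    have "\<epsilon> \<le> e \<or> (\<forall>k<N. radius (Z k) \<in> {\<rho>1..\<rho>2})"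
      using run by auto
    note IH' = IH[rule_format, OF conjI[OF conjunct1[OF run] this]]
    have "W k \<in> tube \<rho>1 \<rho>2 C' \<and> norm (Z k - W k) \<le> C' * \<epsilon> \<and> norm (u k) \<le> C' \<and>
        (1 \<le> k \<longrightarrow> norm (u k) \<le> C' * \<epsilon>)"
    proof (cases "k \<le> n")
      case True
      have "C * \<epsilon> \<le> C' * \<epsilon>"
        using C' \<epsilon> by (intro mult_right_mono) auto
      then show ?thesis
        using IH'[OF True k(2)] C'(1) tube_mono[of \<rho>1 \<rho>1 \<rho>2 \<rho>2 C C'] by auto
    next
      case False
      then have k: "k = Suc n" "n < N"
        using k by auto
      have "W n \<in> tube \<rho>1 \<rho>2 C" "norm (Z n - W n) \<le> C * \<epsilon>" "norm (u n) \<le> C"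
        using IH'[of n] k by auto
      then have "W (Suc n) \<in> tube \<rho>1 \<rho>2 C' \<and> norm (Z (Suc n) - W (Suc n)) \<le> C' * \<epsilon> \<and>
          norm (u (Suc n)) \<le> C' * \<epsilon>"
        using run k assms(1)
        by (intro step[OF _ \<epsilon> semi_implicit_schemeD[OF sch k(2)] one_step_schemeD[OF one _ k(2)]]) auto
      moreover have "C' * \<epsilon> \<le> C'"
        using C C' \<epsilon> by (intro mult_left_le) auto
      ultimately show ?thesis
        unfolding k(1) by (auto intro: order_trans)
    qed
    then show "W k \<in> tube \<rho>1 \<rho>2 C'" "norm (Z k - W k) \<le> C' * \<epsilon>" "norm (u k) \<le> C'"
      "1 \<le> k \<Longrightarrow> norm (u k) \<le> C' * \<epsilon>"
      by auto
  qed
qed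

text \<open>The comparison starts at index 1, the first index at which the fast variable is
  O(\<epsilon>), which is why \<open>Y\<close> is started from \<open>Z 1\<close>.\<close>

lemma second_order_error:
  assumes "0 < h" "0 < \<rho>1" "\<rho>2 < R0 D" "0 < M"
  shows "\<exists>C e. 0 < C \<and> 0 < e \<and> (\<forall>\<epsilon> Z u W Y. well_prepared_run D h N \<rho>1 \<rho>2 M \<epsilon> Z u W \<and>
      Y 1 = Z 1 \<and> one_step_scheme h 1 N (corrected_field D \<epsilon>) Y \<and>
      (\<epsilon> \<le> e \<or> (\<forall>k<N. radius (Z k) \<in> {\<rho>1..\<rho>2} \<and> (1 \<le> k \<longrightarrow> radius (Y k) \<in> {\<rho>1..\<rho>2}))) \<longrightarrow>
      (\<forall>k\<in>{1..Suc n}. k \<le> N \<longrightarrow> norm (Z k - Y k) \<le> C * \<epsilon>\<^sup>2 \<and>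
        (2 \<le> k \<longrightarrow> norm (u k - slaved_velocity D \<epsilon> (real (k - 1) * h) (Y (k - 1))) \<le> C * \<epsilon>\<^sup>2)))"
proof (induction n)
  case 0
  \<comment> \<open>Only index 1 occurs, where \<open>Y\<close> and \<open>Z\<close> coincide and
    the fast estimate is vacuous; the values 1 are arbitrary.\<close>
  show ?case
    by (rule exI[of _ 1], rule exI[of _ 1]) auto
next
  case (Suc n)
  from Suc.IH obtain C1 e1 where C1: "0 < C1" "0 < e1" and IH: "\<forall>\<epsilon> Z u W Y. well_prepared_run D h N \<rho>1 \<rho>2 M \<epsilon> Z u W \<and>
      Y 1 = Z 1 \<and> one_step_scheme h 1 N (corrected_field D \<epsilon>) Y \<and>
      (\<epsilon> \<le> e1 \<or> (\<forall>k<N. radius (Z k) \<in> {\<rho>1..\<rho>2} \<and> (1 \<le> k \<longrightarrow> radius (Y k) \<in> {\<rho>1..\<rho>2}))) \<longrightarrow>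
      (\<forall>k\<in>{1..Suc n}. k \<le> N \<longrightarrow> norm (Z k - Y k) \<le> C1 * \<epsilon>\<^sup>2 \<and>
        (2 \<le> k \<longrightarrow> norm (u k - slaved_velocity D \<epsilon> (real (k - 1) * h) (Y (k - 1))) \<le> C1 * \<epsilon>\<^sup>2))"
    by (elim exE conjE) (rule that)
  \<comment> \<open>Taken for all indices at once, because the step from \<open>m\<close> uses the
    O(\<epsilon>) bound on \<open>u\<close> both at \<open>m\<close> and at
    \<open>Suc m\<close>.\<close>
  from first_order_error[OF assms, of N N]
  obtain C2 e2 where C2: "0 < C2" "0 < e2" and first: "\<forall>\<epsilon> Z u W. well_prepared_run D h N \<rho>1 \<rho>2 M \<epsilon> Z u W \<and>
      (\<epsilon> \<le> e2 \<or> (\<forall>k<N. radius (Z k) \<in> {\<rho>1..\<rho>2})) \<longrightarrow>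
      (\<forall>k\<le>N. k \<le> N \<longrightarrow> W k \<in> tube \<rho>1 \<rho>2 C2 \<and> norm (Z k - W k) \<le> C2 * \<epsilon> \<and> norm (u k) \<le> C2 \<and>
        (1 \<le> k \<longrightarrow> norm (u k) \<le> C2 * \<epsilon>))"
    by (elim exE conjE) (rule that)
  define C where "C = C1 + C2"
  have C: "0 < C" "C1 \<le> C" "C2 \<le> C"
    using C1 C2 by (auto simp: C_def)
  obtain C' e' where C': "C \<le> C'" "0 < e'" and step:
    "\<And>t \<epsilon> Z u Z' u' W Y Y'. \<lbrakk>0 \<le> t; 0 < \<epsilon>; \<epsilon> \<le> 1; (Z' - Z) /\<^sub>R h = F D t Z u';
      J0 ((u' - u) /\<^sub>R h) = U_perp D t Z u - (b_at D Z / \<epsilon>) *\<^sub>R u';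
      (Y' - Y) /\<^sub>R h = corrected_field D \<epsilon> t Y;
      W \<in> tube \<rho>1 \<rho>2 C; norm (Z - W) \<le> C * \<epsilon>; norm (Z - Y) \<le> C * \<epsilon>\<^sup>2;
      norm u \<le> C * \<epsilon>; norm u' \<le> C * \<epsilon>;
      \<epsilon> \<le> e' \<or> radius Z \<in> {\<rho>1..\<rho>2} \<and> radius Y \<in> {\<rho>1..\<rho>2}\<rbrakk>
      \<Longrightarrow> norm (Z' - Y') \<le> C' * \<epsilon>\<^sup>2 \<and> norm (u' - slaved_velocity D \<epsilon> t Y) \<le> C' * \<epsilon>\<^sup>2"
    using second_order_step[OF assms(1-3) C(1)] by metis
  define e where "e = min e1 (min e2 e')"
  show ?case
  proof (rule exI[of _ C'], rule exI[of _ e], intro conjI allI impI ballI)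
    show "0 < C'" "0 < e"
      using C C' C1 C2 by (auto simp: e_def)
  next
    fix \<epsilon> Z u W Y k
    assume A: "well_prepared_run D h N \<rho>1 \<rho>2 M \<epsilon> Z u W \<and>
      Y 1 = Z 1 \<and> one_step_scheme h 1 N (corrected_field D \<epsilon>) Y \<and>
      (\<epsilon> \<le> e \<or> (\<forall>k<N. radius (Z k) \<in> {\<rho>1..\<rho>2} \<and> (1 \<le> k \<longrightarrow> radius (Y k) \<in> {\<rho>1..\<rho>2})))"
      and k: "k \<in> {1..Suc (Suc n)}" "k \<le> N"
    then have \<epsilon>: "0 < \<epsilon>" "\<epsilon> \<le> 1" and run: "well_prepared_run D h N \<rho>1 \<rho>2 M \<epsilon> Z u W"
      and sch: "semi_implicit_scheme D h N \<epsilon> Z u"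
      and Y1: "Y 1 = Z 1" and Y: "one_step_scheme h 1 N (corrected_field D \<epsilon>) Y"
      and small: "\<epsilon> \<le> e \<or> (\<forall>k<N. radius (Z k) \<in> {\<rho>1..\<rho>2} \<and> (1 \<le> k \<longrightarrow> radius (Y k) \<in> {\<rho>1..\<rho>2}))"
      by (auto simp: well_prepared_run_def)
    have small': "\<epsilon> \<le> e1 \<or> (\<forall>k<N. radius (Z k) \<in> {\<rho>1..\<rho>2} \<and> (1 \<le> k \<longrightarrow> radius (Y k) \<in> {\<rho>1..\<rho>2}))"
      "\<epsilon> \<le> e2 \<or> (\<forall>k<N. radius (Z k) \<in> {\<rho>1..\<rho>2})"
      "\<epsilon> \<le> e' \<or> (\<forall>k<N. radius (Z k) \<in> {\<rho>1..\<rho>2} \<and> (1 \<le> k \<longrightarrow> radius (Y k) \<in> {\<rho>1..\<rho>2}))"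
      using small by (auto simp: e_def)
    note IH' = IH[rule_format, OF conjI[OF run conjI[OF Y1 conjI[OF Y small'(1)]]]]
      and first' = first[rule_format, OF conjI[OF run small'(2)]]
    have mono: "C1 * \<epsilon>\<^sup>2 \<le> C * \<epsilon>\<^sup>2" "C * \<epsilon>\<^sup>2 \<le> C' * \<epsilon>\<^sup>2" "C2 * \<epsilon> \<le> C * \<epsilon>"
      using C C' \<epsilon> by (auto intro!: mult_right_mono)
    have "norm (Z k - Y k) \<le> C' * \<epsilon>\<^sup>2 \<and>
        (2 \<le> k \<longrightarrow> norm (u k - slaved_velocity D \<epsilon> (real (k - 1) * h) (Y (k - 1))) \<le> C' * \<epsilon>\<^sup>2)"
    proof (cases "k \<le> Suc n")
      case True
      then show ?thesis
        using IH'[of k] k mono by auto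
    next
      case False
      \<comment> \<open>The new index is \<open>k = Suc m\<close>, so the slaved velocity is
        evaluated at time and position \<open>m\<close>.\<close>
      define m where "m = Suc n"
      have m: "k = Suc m" "m < N" "1 \<le> m" "m \<le> Suc n"
        using False k by (auto simp: m_def)
      have "W m \<in> tube \<rho>1 \<rho>2 C"
        using first'[of m] m tube_mono[of \<rho>1 \<rho>1 \<rho>2 \<rho>2 C2 C] C by auto
      moreover have "norm (Z m - W m) \<le> C * \<epsilon>" "norm (u m) \<le> C * \<epsilon>" "norm (u (Suc m)) \<le> C * \<epsilon>"
        using first'[of m] first'[of "Suc m"] m mono(3) by auto
      moreover have "norm (Z m - Y m) \<le> C * \<epsilon>\<^sup>2"
        using IH'[of m] m mono(1) by auto
      moreover have "\<epsilon> \<le> e' \<or> radius (Z m) \<in> {\<rho>1..\<rho>2} \<and> radius (Y m) \<in> {\<rho>1..\<rho>2}"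
        using small'(3) m by blast
      moreover have "0 \<le> real m * h"
        using assms(1) by simp
      ultimately have "norm (Z (Suc m) - Y (Suc m)) \<le> C' * \<epsilon>\<^sup>2 \<and>
          norm (u (Suc m) - slaved_velocity D \<epsilon> (real m * h) (Y m)) \<le> C' * \<epsilon>\<^sup>2"
        by (intro step[OF _ \<epsilon> semi_implicit_schemeD[OF sch m(2)] one_step_schemeD[OF Y m(3,2)]])
      then show ?thesis
        unfolding m(1) by simp
    qed
    then show "norm (Z k - Y k) \<le> C' * \<epsilon>\<^sup>2"
      "2 \<le> k \<Longrightarrow> norm (u k - slaved_velocity D \<epsilon> (real (k - 1) * h) (Y (k - 1))) \<le> C' * \<epsilon>\<^sup>2"
      by auto
  qed
qed

end

section \<open>Limit of the scheme\<close>

context toroidal_fields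
begin

text \<open>In terms of \<open>p = sqrt \<epsilon> *\<^sub>R u\<close>, multiplying by \<epsilon>
  gives the constant, linear and quadratic parts of \<open>U_perp\<close> the weights \<epsilon>,
  \<open>sqrt \<epsilon>\<close> and 1. The quadratic part is small only through \<open>p\<close>,
  which explains the scaling in the hypothesis of (i).\<close>

lemma U_perp_growth:
  assumes "0 < \<epsilon>" "0 \<le> K" "norm (sqrt \<epsilon> *\<^sub>R u) \<le> 1"
    and bound: "\<And>p. norm p \<le> 1 \<Longrightarrow> norm (U_perp D t Z p) \<le> K"
    and lip: "\<And>p q. norm p \<le> 1 \<Longrightarrow> norm q \<le> 1 \<Longrightarrow> norm (U_perp D t Z p - U_perp D t Z q) \<le> K * norm (p - q)"
  shows "\<epsilon> * norm (U_perp D t Z u) \<le> \<epsilon> * K + sqrt \<epsilon> * K + K * norm (sqrt \<epsilon> *\<^sub>R u)"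
proof -
  define s where "s = sqrt \<epsilon>"
  have s: "0 < s" "\<epsilon> = s\<^sup>2"
    using assms(1) by (auto simp: s_def)
  define p where "p = s *\<^sub>R u"
  have p: "norm p \<le> 1" "norm (- p) \<le> 1" "u = (1 / s) *\<^sub>R p"
    using assms(3) s(1) by (auto simp: p_def s_def)
  let ?U = "U_perp D t Z"
  \<comment> \<open>Writes the quadratic part as an average of increments from the value at 0, so
    that the Lipschitz bound yields a factor \<open>norm p\<close>.\<close>
  have half: "(1 / 2) *\<^sub>R ((x - z) + (y - z)) = (1 / 2) *\<^sub>R (x + y) - z" for x y z :: fast
    by (cases x; cases y; cases z) (simp add: field_simps)
  have "\<epsilon> *\<^sub>R ?U u = \<epsilon> *\<^sub>R ?U 0 + (s / 2) *\<^sub>R (?U p - ?U (- p))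
      + (1 / 2) *\<^sub>R ((?U p - ?U 0) + (?U (- p) - ?U 0))"
    unfolding p(3) U_perp_scaleR[of D t Z "1 / s"] half using s
    by (simp add: power2_eq_square scaleR_add_right)
  then have "norm (\<epsilon> *\<^sub>R ?U u) \<le> norm (\<epsilon> *\<^sub>R ?U 0) + norm ((s / 2) *\<^sub>R (?U p - ?U (- p)))
      + norm ((1 / 2) *\<^sub>R ((?U p - ?U 0) + (?U (- p) - ?U 0)))"
    by (metis norm_triangle_le norm_triangle_ineq add_mono order_refl)
  also have "\<dots> \<le> \<epsilon> * K + s / 2 * (2 * K) + 1 / 2 * (2 * (K * norm p))"
  proof (intro add_mono)
    show "norm (\<epsilon> *\<^sub>R ?U 0) \<le> \<epsilon> * K"
      using assms(1) bound[of 0] by (simp add: mult_left_mono)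
    show "norm ((s / 2) *\<^sub>R (?U p - ?U (- p))) \<le> s / 2 * (2 * K)"
      using s(1) norm_triangle_ineq4[of "?U p" "?U (- p)"] bound[OF p(1)] bound[OF p(2)] by simp
    show "norm ((1 / 2) *\<^sub>R ((?U p - ?U 0) + (?U (- p) - ?U 0))) \<le> 1 / 2 * (2 * (K * norm p))"
      using norm_triangle_ineq[of "?U p - ?U 0" "?U (- p) - ?U 0"] lip[OF p(1), of 0] lip[OF p(2), of 0]
      by simp
  qed
  finally show ?thesis
    using assms(1) by (simp add: p_def s_def)
qed

text \<open>A limit version of the first-order step: no rate is available for the data, so all
  estimates hold eventually as \<epsilon> tends to 0.\<close>

lemma asymptotic_step:
  fixes Z Z' :: "real \<Rightarrow> slow" and u u' :: "real \<Rightarrow> fast"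
  assumes "0 < h" "0 \<le> t"
    and Z': "\<And>\<epsilon>. \<epsilon> \<in> {0<..1} \<Longrightarrow> (Z' \<epsilon> - Z \<epsilon>) /\<^sub>R h = F D t (Z \<epsilon>) (u' \<epsilon>)"
    and u': "\<And>\<epsilon>. \<epsilon> \<in> {0<..1} \<Longrightarrow>
      J0 ((u' \<epsilon> - u \<epsilon>) /\<^sub>R h) = U_perp D t (Z \<epsilon>) (u \<epsilon>) - (b_at D (Z \<epsilon>) / \<epsilon>) *\<^sub>R u' \<epsilon>"
    and W': "(W' - W) /\<^sub>R h = gyrokinetic_field D t W"
    and W: "W \<in> slow_domain D"
    and limZ: "(Z \<longlongrightarrow> W) (at_right 0)"
    and limu: "((\<lambda>\<epsilon>. sqrt \<epsilon> *\<^sub>R u \<epsilon>) \<longlongrightarrow> 0) (at_right 0)"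
  shows "W' \<in> slow_domain D" "(Z' \<longlongrightarrow> W') (at_right 0)" "(u' \<longlongrightarrow> 0) (at_right 0)"
proof -
  \<comment> \<open>A ball around \<open>W\<close>, so that convergence puts all
    \<open>Z \<epsilon>\<close> eventually in one tube with constants independent of
    \<epsilon>.\<close>
  obtain \<delta> where \<delta>: "0 < \<delta>" "cball W \<delta> \<subseteq> slow_domain D"
    using open_slow_domain W open_contains_cball by blast
  obtain \<rho>1 \<rho>2 B where \<rho>: "0 < \<rho>1" "\<rho>2 < R0 D" and B: "cball W \<delta> \<subseteq> tube \<rho>1 \<rho>2 B"
    using compact_subset_tube[OF compact_cball \<delta>(2)] by blast
  have WB: "W \<in> tube \<rho>1 \<rho>2 B"
    using B \<delta>(1) by auto
  obtain c where c: "0 < c" "\<And>Z B. Z \<in> tube \<rho>1 \<rho>2 B \<Longrightarrow> c \<le> b_at D Z"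
    using b_at_bounded_below[OF \<rho>] by metis
  obtain K where K: "0 < K"
    "\<And>t Z u. 0 \<le> t \<Longrightarrow> Z \<in> tube \<rho>1 \<rho>2 B \<Longrightarrow> norm u \<le> 1 \<Longrightarrow> norm (U_perp D t Z u) \<le> K"
    "\<And>t Z Z' u u'. 0 \<le> t \<Longrightarrow> Z \<in> tube \<rho>1 \<rho>2 B \<Longrightarrow> Z' \<in> tube \<rho>1 \<rho>2 B \<Longrightarrow> norm u \<le> 1 \<Longrightarrow>
      norm u' \<le> 1 \<Longrightarrow> norm (U_perp D t Z u - U_perp D t Z' u') \<le> K * (norm (Z - Z') + norm (u - u'))"
    using bdd_lipschitz_productE[OF U_perp_bdd_lipschitz[OF \<rho>]] by metis
  obtain KF where KF: "0 < KF"
    "\<And>t Z Z' u u'. 0 \<le> t \<Longrightarrow> Z \<in> tube \<rho>1 \<rho>2 B \<Longrightarrow> Z' \<in> tube \<rho>1 \<rho>2 B \<Longrightarrow> norm u \<le> 1 \<Longrightarrow>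
      norm u' \<le> 1 \<Longrightarrow> norm (F D t Z u - F D t Z' u') \<le> KF * (norm (Z - Z') + norm (u - u'))"
    using bdd_lipschitz_productE[OF F_bdd_lipschitz[OF \<rho>]] by metis
  have ev: "\<forall>\<^sub>F \<epsilon> in at_right 0. \<epsilon> \<in> {0<..(1::real)}"
    unfolding eventually_at_right_field by (intro exI[of _ 1]) auto
  have evZ: "\<forall>\<^sub>F \<epsilon> in at_right 0. Z \<epsilon> \<in> tube \<rho>1 \<rho>2 B"
    using tendstoD[OF limZ \<delta>(1)] by eventually_elim (use B in \<open>auto simp: dist_commute\<close>)
  have evu: "\<forall>\<^sub>F \<epsilon> in at_right 0. norm (sqrt \<epsilon> *\<^sub>R u \<epsilon>) \<le> 1"
    using tendstoD[OF limu zero_less_one] by eventually_elim simp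
  have id: "((\<lambda>\<epsilon>. \<epsilon>) \<longlongrightarrow> 0) (at_right (0::real))"
    by (rule tendsto_ident_at)
  have root: "(sqrt \<longlongrightarrow> 0) (at_right 0)"
    using tendsto_real_sqrt[OF id] by simp
  \<comment> \<open>The implicit bound with \<epsilon> moved into the numerator: \<epsilon> times
    the norm of \<open>u\<close> equals \<open>sqrt \<epsilon>\<close> times that of the scaled
    \<open>u\<close>, and \<open>U_perp_growth\<close> treats the rest. Every summand tends to
    0.\<close>
  define g where "g \<epsilon> = (sqrt \<epsilon> * norm (sqrt \<epsilon> *\<^sub>R u \<epsilon>) / h
      + (\<epsilon> * K + sqrt \<epsilon> * K + K * norm (sqrt \<epsilon> *\<^sub>R u \<epsilon>))) / c" for \<epsilon>
  have "(g \<longlongrightarrow> (0 * norm (0::fast) / h + (0 * K + 0 * K + K * norm (0::fast))) / c) (at_right 0)"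
    unfolding g_def using assms(1) c(1) by (intro tendsto_intros id root limu) auto
  then have "(g \<longlongrightarrow> 0) (at_right 0)"
    by simp
  moreover have "\<forall>\<^sub>F \<epsilon> in at_right 0. norm (u' \<epsilon>) \<le> g \<epsilon>"
    using ev evZ evu
  proof eventually_elim
    case (elim \<epsilon>)
    have b: "c \<le> b_at D (Z \<epsilon>)" "0 < b_at D (Z \<epsilon>)"
      using c(2)[OF elim(2)] c(1) by auto
    have "norm (u' \<epsilon>) \<le> (norm (u \<epsilon>) / h + norm (U_perp D t (Z \<epsilon>) (u \<epsilon>))) / (b_at D (Z \<epsilon>) / \<epsilon>)"
      using elim(1) b assms(1) by (intro implicit_step_norm_le[OF u']) auto
    also have "\<dots> = (\<epsilon> * norm (u \<epsilon>) / h + \<epsilon> * norm (U_perp D t (Z \<epsilon>) (u \<epsilon>))) / b_at D (Z \<epsilon>)"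
      using elim(1) by (simp add: field_simps)
    also have "\<epsilon> * norm (u \<epsilon>) = sqrt \<epsilon> * norm (sqrt \<epsilon> *\<^sub>R u \<epsilon>)"
      using elim(1) by simp
    also have "(\<dots> / h + \<epsilon> * norm (U_perp D t (Z \<epsilon>) (u \<epsilon>))) / b_at D (Z \<epsilon>) \<le> g \<epsilon>"
      unfolding g_def
    proof (intro frac_le add_mono order_refl b c(1))
      show "\<epsilon> * norm (U_perp D t (Z \<epsilon>) (u \<epsilon>)) \<le> \<epsilon> * K + sqrt \<epsilon> * K + K * norm (sqrt \<epsilon> *\<^sub>R u \<epsilon>)"
        using elim K(1,2) K(3)[OF assms(2) elim(2) elim(2)] assms(2)
        by (intro U_perp_growth) auto
    qed (use elim(1) K(1) assms(1) in auto)
    finally show ?case .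
  qed
  ultimately show limu': "(u' \<longlongrightarrow> 0) (at_right 0)"
    by (rule Lim_null_comparison[rotated])
  have evu': "\<forall>\<^sub>F \<epsilon> in at_right 0. norm (u' \<epsilon>) \<le> 1"
    using tendstoD[OF limu' zero_less_one] by eventually_elim simp
  have limd: "((\<lambda>\<epsilon>. norm (Z \<epsilon> - W)) \<longlongrightarrow> 0) (at_right 0)"
    using limZ by (simp add: LIM_zero_iff tendsto_norm_zero_iff)
  have "((\<lambda>\<epsilon>. norm (Z \<epsilon> - W) + h * KF * (norm (Z \<epsilon> - W) + norm (u' \<epsilon>))) \<longlongrightarrow>
      0 + h * KF * (0 + norm (0::fast))) (at_right 0)"
    by (intro tendsto_intros limd limu')
  then have "((\<lambda>\<epsilon>. norm (Z \<epsilon> - W) + h * KF * (norm (Z \<epsilon> - W) + norm (u' \<epsilon>))) \<longlongrightarrow> 0) (at_right 0)"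
    by simp
  moreover have "\<forall>\<^sub>F \<epsilon> in at_right 0.
      norm (Z' \<epsilon> - W') \<le> norm (Z \<epsilon> - W) + h * KF * (norm (Z \<epsilon> - W) + norm (u' \<epsilon>))"
    using ev evZ evu'
  proof eventually_elim
    case (elim \<epsilon>)
    have "norm (F D t (Z \<epsilon>) (u' \<epsilon>) - gyrokinetic_field D t W) \<le> KF * (norm (Z \<epsilon> - W) + norm (u' \<epsilon>))"
      using KF(2)[OF assms(2) elim(2) WB elim(3), of 0] by (simp add: gyrokinetic_field_def)
    then show ?case
      unfolding euler_step_eq[OF assms(1) Z'[OF elim(1)]] euler_step_eq[OF assms(1) W']
      using assms(1) KF(1) by (intro norm_euler_step_diff_le) auto
  qed
  ultimately have "((\<lambda>\<epsilon>. Z' \<epsilon> - W') \<longlongrightarrow> 0) (at_right 0)"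
    by (rule Lim_null_comparison[rotated])
  then show "(Z' \<longlongrightarrow> W') (at_right 0)"
    by (simp add: LIM_zero_iff)
  show "W' \<in> slow_domain D"
    using W unfolding euler_step_eq[OF assms(1) W']
    by (simp add: slow_domain_def radius_add_scaleR gyrokinetic_field_radius)
qed

text \<open>The induction carries the limit of the scaled fast variable, the only fast information
  at index 0; convergence of \<open>u\<close> itself follows from index 1 on.\<close>

lemma asymptotic_limit:
  assumes "0 < h"
    and sch: "\<forall>\<epsilon>\<in>{0<..1}. semi_implicit_scheme D h N \<epsilon> (Z \<epsilon>) (u \<epsilon>)"
    and W: "one_step_scheme h 0 N (gyrokinetic_field D) W" "W 0 \<in> slow_domain D"
    and lim: "((\<lambda>\<epsilon>. (Z \<epsilon> 0, sqrt \<epsilon> *\<^sub>R u \<epsilon> 0)) \<longlongrightarrow> (W 0, 0)) (at_right 0)"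
    and "n \<le> N"
  shows "W n \<in> slow_domain D \<and> ((\<lambda>\<epsilon>. Z \<epsilon> n) \<longlongrightarrow> W n) (at_right 0) \<and>
    ((\<lambda>\<epsilon>. sqrt \<epsilon> *\<^sub>R u \<epsilon> n) \<longlongrightarrow> 0) (at_right 0) \<and>
    (1 \<le> n \<longrightarrow> ((\<lambda>\<epsilon>. u \<epsilon> n) \<longlongrightarrow> 0) (at_right 0))"
  using \<open>n \<le> N\<close>
proof (induction n)
  case 0
  show ?case
    using tendsto_fst[OF lim] tendsto_snd[OF lim] W(2) by simp
next
  case (Suc n)
  then have n: "n < N" and IH: "W n \<in> slow_domain D" "((\<lambda>\<epsilon>. Z \<epsilon> n) \<longlongrightarrow> W n) (at_right 0)"
    "((\<lambda>\<epsilon>. sqrt \<epsilon> *\<^sub>R u \<epsilon> n) \<longlongrightarrow> 0) (at_right 0)"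
    by auto
  have t: "0 \<le> real n * h"
    using assms(1) by simp
  note step = asymptotic_step[OF assms(1) t semi_implicit_schemeD(1)[OF bspec[OF sch] n]
      semi_implicit_schemeD(2)[OF bspec[OF sch] n] one_step_schemeD[OF W(1) _ n] IH, simplified]
  have "(sqrt \<longlongrightarrow> 0) (at_right 0)"
    using tendsto_real_sqrt[OF tendsto_ident_at[of 0 "{0<..}"]] by simp
  from tendsto_scaleR[OF this step(3)] have "((\<lambda>\<epsilon>. sqrt \<epsilon> *\<^sub>R u \<epsilon> (Suc n)) \<longlongrightarrow> 0) (at_right 0)"
    by simp
  then show ?case
    using step by simp
qed

end

theorem proposition4p2:
  fixes D :: toroidal_data and h T :: real
  assumes "standing_assumptions D" and "0 < h" and "0 < T"
  shows
    "\<comment> \<open>(i)\<close>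
     (\<forall>Z u Z0 Zlim.
        (\<forall>\<epsilon>\<in>{0<..1}. semi_implicit_scheme D h (num_steps T h) \<epsilon> (Z \<epsilon>) (u \<epsilon>)) \<and>
        Z0 \<in> slow_domain D \<and>
        ((\<lambda>\<epsilon>. (Z \<epsilon> 0, sqrt \<epsilon> *\<^sub>R u \<epsilon> 0)) \<longlongrightarrow> (Z0, 0)) (at_right 0) \<and>
        Zlim 0 = Z0 \<and>
        one_step_scheme h 0 (num_steps T h) (gyrokinetic_field D) Zlim \<longrightarrow>
        (\<forall>n\<in>{1..num_steps T h}. ((\<lambda>\<epsilon>. (Z \<epsilon> n, u \<epsilon> n)) \<longlongrightarrow> (Zlim n, 0)) (at_right 0)))
     \<and> consistent_first_order T (slow_domain D) (gyrokinetic_field D) (gyrokinetic_field D)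
     \<and> \<comment> \<open>(ii)\<close>
     (\<forall>M>0. \<forall>\<rho>1 \<rho>2 V. 0 < \<rho>1 \<and> \<rho>1 \<le> \<rho>2 \<and> \<rho>2 < R0 D \<longrightarrow>
       (\<exists>C>0. \<exists>\<epsilon>0>0. \<forall>Z u Z0 Zlim Y.
          (\<forall>\<epsilon>\<in>{0<..1}. semi_implicit_scheme D h (num_steps T h) \<epsilon> (Z \<epsilon>) (u \<epsilon>)) \<and>
          radius Z0 \<in> {\<rho>1..\<rho>2} \<and> \<bar>v_par Z0\<bar> \<le> V \<and> \<bar>b_mu Z0\<bar> \<le> V \<and>
          (\<forall>\<epsilon>\<in>{0<..1}. norm ((Z \<epsilon> 0 - Z0) /\<^sub>R \<epsilon>, u \<epsilon> 0) \<le> M) \<and>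
          Zlim 0 = Z0 \<and>
          one_step_scheme h 0 (num_steps T h) (gyrokinetic_field D) Zlim \<and>
          (\<forall>\<epsilon>\<in>{0<..1}. Y \<epsilon> 1 = Z \<epsilon> 1 \<and>
             one_step_scheme h 1 (num_steps T h) (corrected_field D \<epsilon>) (Y \<epsilon>)) \<longrightarrow>
          (\<forall>\<epsilon>\<in>{0<..1}.
             (\<epsilon> \<le> \<epsilon>0 \<or> (\<forall>n<num_steps T h. radius (Z \<epsilon> n) \<in> {\<rho>1..\<rho>2}) \<longrightarrow>
               (\<forall>n\<in>{1..num_steps T h}.
                  norm (Z \<epsilon> n - Zlim n) + norm (u \<epsilon> n) \<le> C * \<epsilon>)) \<and>
             (\<epsilon> \<le> \<epsilon>0 \<or> (\<forall>n<num_steps T h. radius (Z \<epsilon> n) \<in> {\<rho>1..\<rho>2} \<and>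
                             (1 \<le> n \<longrightarrow> radius (Y \<epsilon> n) \<in> {\<rho>1..\<rho>2})) \<longrightarrow>
               (\<forall>n\<in>{2..num_steps T h}.
                  norm (Z \<epsilon> n - Y \<epsilon> n)
                  + norm (u \<epsilon> n - slaved_velocity D \<epsilon> (real (n - 1) * h) (Y \<epsilon> (n - 1)))
                    \<le> C * \<epsilon>\<^sup>2)))))
     \<and> (\<forall>\<epsilon>\<in>{0<..1}. consistent_first_order T (slow_domain D)
                        (corrected_field D \<epsilon>) (corrected_field D \<epsilon>))"
proof -
  interpret toroidal_fields D
    by unfold_locales (rule assms(1))
  let ?N = "num_steps T h"
  have part_i: "\<forall>n\<in>{1..?N}. ((\<lambda>\<epsilon>. (Z \<epsilon> n, u \<epsilon> n)) \<longlongrightarrow> (Zlim n, 0)) (at_right 0)"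
    if A: "(\<forall>\<epsilon>\<in>{0<..1}. semi_implicit_scheme D h ?N \<epsilon> (Z \<epsilon>) (u \<epsilon>)) \<and>
        Z0 \<in> slow_domain D \<and>
        ((\<lambda>\<epsilon>. (Z \<epsilon> 0, sqrt \<epsilon> *\<^sub>R u \<epsilon> 0)) \<longlongrightarrow> (Z0, 0)) (at_right 0) \<and>
        Zlim 0 = Z0 \<and> one_step_scheme h 0 ?N (gyrokinetic_field D) Zlim" for Z u Z0 Zlim
  proof
    fix n assume "n \<in> {1..?N}"
    then show "((\<lambda>\<epsilon>. (Z \<epsilon> n, u \<epsilon> n)) \<longlongrightarrow> (Zlim n, 0)) (at_right 0)"
      using A asymptotic_limit[OF assms(2), of ?N Z u Zlim n] by (auto intro: tendsto_Pair)
  qed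
  have part_ii: "\<exists>C>0. \<exists>\<epsilon>0>0. \<forall>Z u Z0 Zlim Y.
          (\<forall>\<epsilon>\<in>{0<..1}. semi_implicit_scheme D h ?N \<epsilon> (Z \<epsilon>) (u \<epsilon>)) \<and>
          radius Z0 \<in> {\<rho>1..\<rho>2} \<and> \<bar>v_par Z0\<bar> \<le> V \<and> \<bar>b_mu Z0\<bar> \<le> V \<and>
          (\<forall>\<epsilon>\<in>{0<..1}. norm ((Z \<epsilon> 0 - Z0) /\<^sub>R \<epsilon>, u \<epsilon> 0) \<le> M) \<and>
          Zlim 0 = Z0 \<and>
          one_step_scheme h 0 ?N (gyrokinetic_field D) Zlim \<and>
          (\<forall>\<epsilon>\<in>{0<..1}. Y \<epsilon> 1 = Z \<epsilon> 1 \<and>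
             one_step_scheme h 1 ?N (corrected_field D \<epsilon>) (Y \<epsilon>)) \<longrightarrow>
          (\<forall>\<epsilon>\<in>{0<..1}.
             (\<epsilon> \<le> \<epsilon>0 \<or> (\<forall>n<?N. radius (Z \<epsilon> n) \<in> {\<rho>1..\<rho>2}) \<longrightarrow>
               (\<forall>n\<in>{1..?N}.
                  norm (Z \<epsilon> n - Zlim n) + norm (u \<epsilon> n) \<le> C * \<epsilon>)) \<and>
             (\<epsilon> \<le> \<epsilon>0 \<or> (\<forall>n<?N. radius (Z \<epsilon> n) \<in> {\<rho>1..\<rho>2} \<and>
                             (1 \<le> n \<longrightarrow> radius (Y \<epsilon> n) \<in> {\<rho>1..\<rho>2})) \<longrightarrow>
               (\<forall>n\<in>{2..?N}.
                  norm (Z \<epsilon> n - Y \<epsilon> n)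
                  + norm (u \<epsilon> n - slaved_velocity D \<epsilon> (real (n - 1) * h) (Y \<epsilon> (n - 1)))
                    \<le> C * \<epsilon>\<^sup>2)))"
    if M: "0 < M" and \<rho>: "0 < \<rho>1 \<and> \<rho>1 \<le> \<rho>2 \<and> \<rho>2 < R0 D" for M \<rho>1 \<rho>2 V
  proof -
    \<comment> \<open>\<open>M + \<bar>V\<bar>\<close> dominates both the initial errors and the
      components \<open>v\<close>, \<open>w\<close> of \<open>Z0\<close>, as a run requires.\<close>
    have \<rho>': "0 < \<rho>1" "\<rho>2 < R0 D" "0 < M + \<bar>V\<bar>"
      using \<rho> M by auto
    from first_order_error[OF assms(2) \<rho>', of ?N ?N]
    obtain C1 e1 where C1: "0 < C1" "0 < e1" and first:
      "\<forall>\<epsilon> Z u W. well_prepared_run D h ?N \<rho>1 \<rho>2 (M + \<bar>V\<bar>) \<epsilon> Z u W \<and>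
      (\<epsilon> \<le> e1 \<or> (\<forall>k<?N. radius (Z k) \<in> {\<rho>1..\<rho>2})) \<longrightarrow>
      (\<forall>k\<le>?N. k \<le> ?N \<longrightarrow> W k \<in> tube \<rho>1 \<rho>2 C1 \<and> norm (Z k - W k) \<le> C1 * \<epsilon> \<and> norm (u k) \<le> C1 \<and>
        (1 \<le> k \<longrightarrow> norm (u k) \<le> C1 * \<epsilon>))"
      by (elim exE conjE) (rule that)
    from second_order_error[OF assms(2) \<rho>', of ?N ?N]
    obtain C2 e2 where C2: "0 < C2" "0 < e2" and second:
      "\<forall>\<epsilon> Z u W Y. well_prepared_run D h ?N \<rho>1 \<rho>2 (M + \<bar>V\<bar>) \<epsilon> Z u W \<and>
      Y 1 = Z 1 \<and> one_step_scheme h 1 ?N (corrected_field D \<epsilon>) Y \<and>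
      (\<epsilon> \<le> e2 \<or> (\<forall>k<?N. radius (Z k) \<in> {\<rho>1..\<rho>2} \<and> (1 \<le> k \<longrightarrow> radius (Y k) \<in> {\<rho>1..\<rho>2}))) \<longrightarrow>
      (\<forall>k\<in>{1..Suc ?N}. k \<le> ?N \<longrightarrow> norm (Z k - Y k) \<le> C2 * \<epsilon>\<^sup>2 \<and>
        (2 \<le> k \<longrightarrow> norm (u k - slaved_velocity D \<epsilon> (real (k - 1) * h) (Y (k - 1))) \<le> C2 * \<epsilon>\<^sup>2))"
      by (elim exE conjE) (rule that)
    \<comment> \<open>Each final estimate adds two norms bounded by the same constant, hence the
      factors 2.\<close>
    define C where "C = 2 * C1 + 2 * C2"
    show ?thesis
    proof (rule exI[of _ C], rule conjI, use C1 C2 in \<open>simp add: C_def\<close>,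
        rule exI[of _ "min e1 e2"], rule conjI, use C1 C2 in simp, intro allI impI ballI, elim conjE)
      fix Z :: "real \<Rightarrow> nat \<Rightarrow> slow" and u :: "real \<Rightarrow> nat \<Rightarrow> fast" and Z0 Zlim Y and \<epsilon> :: real
      assume sch: "\<forall>\<epsilon>\<in>{0<..1}. semi_implicit_scheme D h ?N \<epsilon> (Z \<epsilon>) (u \<epsilon>)"
        and Z0: "radius Z0 \<in> {\<rho>1..\<rho>2}" "\<bar>v_par Z0\<bar> \<le> V" "\<bar>b_mu Z0\<bar> \<le> V"
        and init: "\<forall>\<epsilon>\<in>{0<..1}. norm ((Z \<epsilon> 0 - Z0) /\<^sub>R \<epsilon>, u \<epsilon> 0) \<le> M"
        and Zlim: "Zlim 0 = Z0" "one_step_scheme h 0 ?N (gyrokinetic_field D) Zlim"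
        and Y: "\<forall>\<epsilon>\<in>{0<..1}. Y \<epsilon> 1 = Z \<epsilon> 1 \<and> one_step_scheme h 1 ?N (corrected_field D \<epsilon>) (Y \<epsilon>)"
        and \<epsilon>: "\<epsilon> \<in> {0<..1}"
      have "norm ((Z \<epsilon> 0 - Z0) /\<^sub>R \<epsilon>) \<le> M" "norm (u \<epsilon> 0) \<le> M"
        using order_trans[OF norm_fst_le bspec[OF init \<epsilon>]] order_trans[OF norm_snd_le bspec[OF init \<epsilon>]] .
      moreover have "norm (Z \<epsilon> 0 - Z0) \<le> (M + \<bar>V\<bar>) * \<epsilon>"
      proof (rule order_trans)
        show "norm (Z \<epsilon> 0 - Z0) \<le> M * \<epsilon>"
          using calculation(1) \<epsilon> unfolding norm_scaleR by (simp add: field_simps)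
        show "M * \<epsilon> \<le> (M + \<bar>V\<bar>) * \<epsilon>"
          using \<epsilon> by (intro mult_right_mono) auto
      qed
      ultimately have run: "well_prepared_run D h ?N \<rho>1 \<rho>2 (M + \<bar>V\<bar>) \<epsilon> (Z \<epsilon>) (u \<epsilon>) Zlim"
        using \<epsilon> sch Zlim Z0 M unfolding well_prepared_run_def by (auto simp: tube_def)
      show "(\<epsilon> \<le> min e1 e2 \<or> (\<forall>n<?N. radius (Z \<epsilon> n) \<in> {\<rho>1..\<rho>2}) \<longrightarrow>
               (\<forall>n\<in>{1..?N}. norm (Z \<epsilon> n - Zlim n) + norm (u \<epsilon> n) \<le> C * \<epsilon>)) \<and>
             (\<epsilon> \<le> min e1 e2 \<or> (\<forall>n<?N. radius (Z \<epsilon> n) \<in> {\<rho>1..\<rho>2} \<and>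
                             (1 \<le> n \<longrightarrow> radius (Y \<epsilon> n) \<in> {\<rho>1..\<rho>2})) \<longrightarrow>
               (\<forall>n\<in>{2..?N}. norm (Z \<epsilon> n - Y \<epsilon> n)
                  + norm (u \<epsilon> n - slaved_velocity D \<epsilon> (real (n - 1) * h) (Y \<epsilon> (n - 1)))
                    \<le> C * \<epsilon>\<^sup>2))"
      proof (intro conjI impI ballI)
        fix n assume small: "\<epsilon> \<le> min e1 e2 \<or> (\<forall>n<?N. radius (Z \<epsilon> n) \<in> {\<rho>1..\<rho>2})"
          and n: "n \<in> {1..?N}"
        have small': "\<epsilon> \<le> e1 \<or> (\<forall>k<?N. radius (Z \<epsilon> k) \<in> {\<rho>1..\<rho>2})"
          using small by auto
        have "norm (Z \<epsilon> n - Zlim n) \<le> C1 * \<epsilon>" "norm (u \<epsilon> n) \<le> C1 * \<epsilon>"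
          using first[rule_format, OF conjI[OF run small'], of n] n by auto
        moreover have "2 * C1 * \<epsilon> \<le> C * \<epsilon>"
          using C2 \<epsilon> by (intro mult_right_mono) (auto simp: C_def)
        ultimately show "norm (Z \<epsilon> n - Zlim n) + norm (u \<epsilon> n) \<le> C * \<epsilon>"
          by linarith
      next
        fix n assume small: "\<epsilon> \<le> min e1 e2 \<or> (\<forall>n<?N. radius (Z \<epsilon> n) \<in> {\<rho>1..\<rho>2} \<and>
            (1 \<le> n \<longrightarrow> radius (Y \<epsilon> n) \<in> {\<rho>1..\<rho>2}))" and n: "n \<in> {2..?N}"
        have small': "\<epsilon> \<le> e2 \<or> (\<forall>n<?N. radius (Z \<epsilon> n) \<in> {\<rho>1..\<rho>2} \<and>
            (1 \<le> n \<longrightarrow> radius (Y \<epsilon> n) \<in> {\<rho>1..\<rho>2}))"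
          using small by auto
        have Y1: "Y \<epsilon> 1 = Z \<epsilon> 1" "one_step_scheme h 1 ?N (corrected_field D \<epsilon>) (Y \<epsilon>)"
          using bspec[OF Y \<epsilon>] by auto
        have "norm (Z \<epsilon> n - Y \<epsilon> n) \<le> C2 * \<epsilon>\<^sup>2"
          "norm (u \<epsilon> n - slaved_velocity D \<epsilon> (real (n - 1) * h) (Y \<epsilon> (n - 1))) \<le> C2 * \<epsilon>\<^sup>2"
          using second[rule_format, OF conjI[OF run conjI[OF Y1(1) conjI[OF Y1(2) small']]], of n] n
          by auto
        moreover have "2 * C2 * \<epsilon>\<^sup>2 \<le> C * \<epsilon>\<^sup>2"
          using C1 by (intro mult_right_mono) (auto simp: C_def)
        ultimately show "norm (Z \<epsilon> n - Y \<epsilon> n)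
            + norm (u \<epsilon> n - slaved_velocity D \<epsilon> (real (n - 1) * h) (Y \<epsilon> (n - 1))) \<le> C * \<epsilon>\<^sup>2"
          by linarith
      qed
    qed
  qed
  show ?thesis
    by (rule conjI, intro allI impI, erule part_i,
        rule conjI, rule consistent_first_order_fields(1)[OF assms(3)],
        rule conjI, intro allI impI, erule (1) part_ii,
        intro ballI, rule consistent_first_order_fields(2)[OF assms(3)])
qed

end
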